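(* Let $PD(n)$ denote the number of partitions of $n$ with designated summands. Then $$\sum_{n=0}^{\infty} PD(3n)q^n = \frac{1}{(q;q^6)_\infty^5 (q^3;q^6)_\infty^2 (q^5;q^6)_\infty^5}\left(\frac{(q^4;q^4)_\infty^6 (q^6;q^6)_\infty^4}{(q^2;q^2)_\infty^{10}(q^{12};q^{12})_\infty^2} + 3q^2\,\frac{(q^{12};q^{12})_\infty^6}{(q^2;q^2)_\infty^6 (q^4;q^4)_\infty^2}\right).$$
   Context: A partition of $n$ with designated summands is an ordinary partition of $n$ in which, for each part size that occurs, exactly one of the parts of that size is designated; if a size $t$ occurs $m_t$ times, the copies are regarded as ordered and the designation may be placed on any one of the $m_t$ positions, different positions giving different objects (e.g. $2'+2$ and $2+2'$ are distinct). $PD(n)$ is the number of such objects, $PD(0)=1$. Notation: $(a;q)_\infty=\prod_{n\ge1}(1-aq^{n-1})$; identities are of formal power series in $q$ (equivalently for $|q|<1$). *)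

theory Defs
  imports "HOL-Analysis.Analysis" "HOL-Library.Multiset"
begin

text \<open>
  A partition of \<open>n\<close> is a multiset \<open>p\<close> of positive integers with sum \<open>n\<close>. The designation \<open>d\<close>
  selects, for each part size \<open>t\<close> that occurs, one of the positions \<open>1, \<dots>, count p t\<close> among the
  ordered copies of \<open>t\<close>; it is extensional, so that it carries no information on other sizes.
\<close>

definition designated_partitions :: "nat \<Rightarrow> (nat multiset \<times> (nat \<Rightarrow> nat)) set" where
  "designated_partitions n =
     (SIGMA p : {p. 0 \<notin># p \<and> sum_mset p = n}. \<Pi>\<^sub>E t\<in>set_mset p. {1..count p t})"

definition PD :: "nat \<Rightarrow> nat" where
  "PD n = card (designated_partitions n)"

lemma finite_designated_partitions: "finite (designated_partitions n)"
proof -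
  have "size p \<le> n \<and> set_mset p \<subseteq> {..n}" if "0 \<notin># p" "sum_mset p = n" for p :: "nat multiset"
    using that
  proof (induction p arbitrary: n)
    case (add x p)
    from add.IH[of "sum_mset p"] add.prems show ?case by (auto simp: subset_iff)
  qed auto
  hence "{p :: nat multiset. 0 \<notin># p \<and> sum_mset p = n} \<subseteq>
           (\<Union>k\<le>n. {p. set_mset p \<subseteq> {..n} \<and> size p = k})"
    by blast
  moreover have "finite (\<Union>k\<le>n. {p. set_mset p \<subseteq> {..n} \<and> size p = k})"
    using finite_multisets_of_size[of "{..n}"] by (intro finite_UN_I) (simp_all add: multisets_of_size_def)
  ultimately have "finite {p :: nat multiset. 0 \<notin># p \<and> sum_mset p = n}"
    by (rule finite_subset)
  thus ?thesis
    unfolding designated_partitions_def by (intro finite_SigmaI finite_PiE) auto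
qed

lemma PD_0: "PD 0 = 1"
proof -
  have "p = {#}" if "0 \<notin># p" "sum_mset p = 0" for p :: "nat multiset"
    using that by (cases p) auto
  hence "{p :: nat multiset. 0 \<notin># p \<and> sum_mset p = 0} = {{#}}" by auto
  thus ?thesis by (simp add: PD_def designated_partitions_def)
qed

text \<open>
  For formal power series the limit in the infinite product is taken with respect to the usual
  (coefficientwise, i.e. \<open>X\<close>-adic) topology.
\<close>

definition qpochhammer_inf :: "'a \<Rightarrow> 'a \<Rightarrow> 'a :: {t2_space, comm_ring_1}"
    (\<open>'(_;/ _')\<^sub>\<infinity>\<close>) where
  "(a; q)\<^sub>\<infinity> = (\<Prod>n. 1 - a * q ^ n)"

lemma has_prod_qpochhammer_inf_fps:
  fixes a q :: "'a :: field fps"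
  assumes "fps_nth a 0 = 0" "fps_nth q 0 = 0"
  shows "(\<lambda>n. 1 - a * q ^ n) has_prod (a; q)\<^sub>\<infinity>"
proof -
  define P where "P = (\<lambda>n. \<Prod>i\<le>n. 1 - a * q ^ i)"
  have small: "fps_nth (F * (a * q ^ n)) m = 0" if "m \<le> n" for F m n
  proof -
    have z: "fps_nth (G * q ^ n) m = 0" if "fps_nth G 0 = 0" "m \<le> n" for G :: "'a fps" and m n
      using that
    proof (induction n arbitrary: m G)
      case (Suc n)
      have *: "fps_nth (G * q ^ n) i * fps_nth q (m - i) = 0" if "i \<le> m" for i
        using Suc.IH[of G i] Suc.prems that assms(2) by (cases "i = m") auto
      have "G * q ^ Suc n = (G * q ^ n) * q" by (simp add: mult_ac)
      hence "fps_nth (G * q ^ Suc n) m = (\<Sum>i=0..m. fps_nth (G * q ^ n) i * fps_nth q (m - i))"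
        by (simp only: fps_mult_nth[of "G * q ^ n" q m])
      also have "\<dots> = 0" by (intro sum.neutral ballI *) simp
      finally show ?case .
    qed auto
    show ?thesis using z[of "F * a" m n] assms(1) that by (simp add: mult_ac)
  qed
  have step: "fps_nth (P (Suc n)) m = fps_nth (P n) m" if "m \<le> n" for m n
  proof -
    have "P (Suc n) = P n - P n * (a * q ^ Suc n)"
      by (simp add: P_def algebra_simps)
    thus ?thesis using small[of m "Suc n" "P n"] that by simp
  qed
  have stab: "fps_nth (P n) m = fps_nth (P m) m" if "m \<le> n" for m n
    using that by (induction n rule: dec_induct) (auto simp: step)
  have lim: "P \<longlonglongrightarrow> Abs_fps (\<lambda>m. fps_nth (P m) m)"
  proof (rule tendsto_fpsI)
    fix m
    show "\<forall>\<^sub>F n in sequentially. fps_nth (P n) m = fps_nth (Abs_fps (\<lambda>m. fps_nth (P m) m)) m"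
      using eventually_ge_at_top[of m] by eventually_elim (simp, rule stab)
  qed
  have "fps_nth (P 0) 0 = 1" using assms by (simp add: P_def)
  hence "Abs_fps (\<lambda>m. fps_nth (P m) m) \<noteq> 0"
    by (metis fps_nth_Abs_fps fps_zero_nth zero_neq_one)
  hence "raw_has_prod (\<lambda>n. 1 - a * q ^ n) 0 (Abs_fps (\<lambda>m. fps_nth (P m) m))"
    using lim by (simp add: raw_has_prod_def P_def)
  hence "(\<lambda>n. 1 - a * q ^ n) has_prod (Abs_fps (\<lambda>m. fps_nth (P m) m))"
    by (simp only: has_prod_def simp_thms)
  from this and has_prod_unique[OF this] show ?thesis
    by (simp only: qpochhammer_inf_def)
qed

end

theory Submission
  imports Defs "HOL-Computational_Algebra.Formal_Laurent_Series"
begin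

text \<open>
  Write \<open>f\<^sub>k = (q\<^sup>k; q\<^sup>k)\<^sub>\<infinity>\<close>. A part size \<open>t\<close> contributes
  \<open>1 + q\<^sup>t / (1 - q\<^sup>t)\<^sup>2 = (1 - q\<^sup>6\<^sup>t) / ((1 - q\<^sup>t) (1 - q\<^sup>2\<^sup>t) (1 - q\<^sup>3\<^sup>t))\<close>,
  so the generating function of \<open>PD\<close> is \<open>f\<^sub>6 / (f\<^sub>1 f\<^sub>2 f\<^sub>3)\<close>. Here \<open>f\<^sub>1 f\<^sub>2 = \<phi>(-q) \<psi>(q)\<close>
  with Ramanujan's theta functions \<open>\<phi>(-q) = f\<^sub>1\<^sup>2 / f\<^sub>2\<close> and \<open>\<psi>(q) = f\<^sub>2\<^sup>2 / f\<^sub>1\<close>. Both have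
  two-term 3-dissections, by the Jacobi triple product; multiplying the conjugates under
  \<open>q \<mapsto> \<omega> q\<close> with \<open>\<omega>\<^sup>3 = 1\<close> rationalizes \<open>1 / (f\<^sub>1 f\<^sub>2)\<close>, and extracting the exponents
  divisible by 3 gives
  \<open>f\<^sub>3\<^sup>9 / (f\<^sub>1\<^sup>7 f\<^sub>2 f\<^sub>6\<^sup>3) - 2 q f\<^sub>6\<^sup>6 / (f\<^sub>1\<^sup>4 f\<^sub>2\<^sup>4)\<close>.

  The norms of the two dissections are also cubic relations between \<open>f\<^sub>1, f\<^sub>2, f\<^sub>3, f\<^sub>6\<close>. Together
  with their images under \<open>q \<mapsto> -q\<close> and \<open>q \<mapsto> q\<^sup>2\<close> they determine the odd part of
  \<open>f\<^sub>3\<^sup>3 / f\<^sub>1\<close> as the root of a cubic equation, whence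
  \<open>f\<^sub>3\<^sup>3 / f\<^sub>1 = f\<^sub>4\<^sup>3 f\<^sub>6\<^sup>2 / (f\<^sub>2\<^sup>2 f\<^sub>1\<^sub>2) + q f\<^sub>1\<^sub>2\<^sup>3 / f\<^sub>4\<close>. Substituting this yields the theorem.
\<close>

unbundle no vec_syntax

section \<open>Infinite products of formal power series\<close>

text \<open>Convergence is coefficientwise and eventually exact, and coefficient \<open>n\<close> of
  a product involves only the coefficients up to \<open>n\<close> of its factors, so finitely many
  eventual equalities suffice.\<close>

lemma tendsto_mult_fps:
  fixes f g :: "'b \<Rightarrow> 'a :: comm_ring_1 fps"
  assumes "(f \<longlongrightarrow> a) F" "(g \<longlongrightarrow> b) F"
  shows "((\<lambda>x. f x * g x) \<longlongrightarrow> a * b) F"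
  unfolding tendsto_fps_iff
proof
  fix n
  have "\<forall>\<^sub>F x in F. \<forall>i\<in>{..n}. f x $ i = a $ i" "\<forall>\<^sub>F x in F. \<forall>i\<in>{..n}. g x $ i = b $ i"
    using assms by (auto simp: tendsto_fps_iff eventually_ball_finite_distrib)
  thus "\<forall>\<^sub>F x in F. (f x * g x) $ n = (a * b) $ n"
    by eventually_elim (auto simp: fps_mult_nth intro!: sum.cong)
qed

lemma tendsto_prod_family_fps:
  fixes f :: "'i \<Rightarrow> 'b \<Rightarrow> 'a :: comm_ring_1 fps"
  assumes "\<And>i. i \<in> I \<Longrightarrow> (f i \<longlongrightarrow> a i) F"
  shows "((\<lambda>x. \<Prod>i\<in>I. f i x) \<longlongrightarrow> (\<Prod>i\<in>I. a i)) F"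
  using assms by (induction I rule: infinite_finite_induct) (auto intro!: tendsto_mult_fps)

lemma tendsto_compose_fps:
  fixes f :: "'b \<Rightarrow> 'a :: comm_ring_1 fps"
  assumes "(f \<longlongrightarrow> a) F"
  shows "((\<lambda>x. f x oo h) \<longlongrightarrow> a oo h) F"
  unfolding tendsto_fps_iff
proof
  fix n
  have "\<forall>\<^sub>F x in F. \<forall>i\<in>{..n}. f x $ i = a $ i"
    using assms by (auto simp: tendsto_fps_iff eventually_ball_finite_distrib)
  thus "\<forall>\<^sub>F x in F. (f x oo h) $ n = (a oo h) $ n"
    by eventually_elim (auto simp: fps_compose_nth intro!: sum.cong)
qed

lemma tendsto_qpochhammer_inf:
  fixes a q :: "'a :: field fps"
  assumes "a $ 0 = 0" "q $ 0 = 0"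
  shows "(\<lambda>n. \<Prod>i<n. 1 - a * q ^ i) \<longlonglongrightarrow> (a; q)\<^sub>\<infinity>"
proof -
  have z: "(a * q ^ i) $ 0 = 0" for i
    using assms by simp
  \<comment> \<open>\<open>has_prod\<close> allows finitely many vanishing factors to be split off;
    the constant term 1 excludes this and leaves plain convergence of the partial products.\<close>
  have nz: "1 - a * q ^ i \<noteq> 0" for i
    using z[of i] by (metis diff_add_cancel diff_zero fps_one_nth one_neq_zero add_0)
  from has_prod_qpochhammer_inf_fps[OF assms]
  have "raw_has_prod (\<lambda>n. 1 - a * q ^ n) 0 (a; q)\<^sub>\<infinity>"
    using nz by (auto simp: has_prod_def)
  hence "(\<lambda>n. \<Prod>i\<le>n. 1 - a * q ^ i) \<longlonglongrightarrow> (a; q)\<^sub>\<infinity>"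
    by (simp add: raw_has_prod_def)
  thus ?thesis
    unfolding lessThan_Suc_atMost[symmetric] by (rule LIMSEQ_imp_Suc)
qed

lemma qpochhammer_inf_nth_0:
  fixes a q :: "'a :: field fps"
  assumes "a $ 0 = 0" "q $ 0 = 0"
  shows "(a; q)\<^sub>\<infinity> $ 0 = 1"
proof -
  have "(\<Prod>i<n. 1 - a * q ^ i) $ 0 = 1" for n
    using assms by (induction n) auto
  with tendsto_qpochhammer_inf[OF assms] show ?thesis
    by (auto simp: tendsto_fps_iff dest: spec[of _ 0])
qed

text \<open>Substitution acts on every partial product and is continuous. With \<open>h\<close>
  equal to \<open>X^j\<close>, \<open>-X\<close> or \<open>c * X\<close> for a cube root of unity
  \<open>c\<close>, this yields the dilated and conjugate products used below.\<close>

lemma qpochhammer_inf_compose: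
  fixes a q h :: "'a :: field fps"
  assumes "a $ 0 = 0" "q $ 0 = 0" "h $ 0 = 0"
  shows "(a; q)\<^sub>\<infinity> oo h = (a oo h; q oo h)\<^sub>\<infinity>"
proof (rule LIMSEQ_unique)
  show "(\<lambda>n. (\<Prod>i<n. 1 - a * q ^ i) oo h) \<longlonglongrightarrow> ((a; q)\<^sub>\<infinity> oo h)"
    by (intro tendsto_compose_fps tendsto_qpochhammer_inf assms)
  have "(\<Prod>i<n. 1 - a * q ^ i) oo h = (\<Prod>i<n. 1 - (a oo h) * (q oo h) ^ i)" for n
    using assms(3) by (simp add: fps_compose_prod_distrib fps_compose_sub_distrib
        fps_compose_mult_distrib fps_compose_power)
  thus "(\<lambda>n. (\<Prod>i<n. 1 - a * q ^ i) oo h) \<longlonglongrightarrow> (a oo h; q oo h)\<^sub>\<infinity>"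
    using tendsto_qpochhammer_inf[of "a oo h" "q oo h"] assms by simp
qed

text \<open>The factors are grouped by the residue of their index mod \<open>d\<close>; the limit is
  taken along the subsequence of partial products of length \<open>d * n\<close>.\<close>

lemma qpochhammer_inf_multisection:
  fixes a q :: "'a :: field fps"
  assumes "a $ 0 = 0" "q $ 0 = 0" "d > 0"
  shows "(a; q)\<^sub>\<infinity> = (\<Prod>r<d. (a * q ^ r; q ^ d)\<^sub>\<infinity>)"
proof (rule LIMSEQ_unique)
  have "strict_mono (\<lambda>n. d * n)"
    using assms by (simp add: strict_mono_def)
  from LIMSEQ_subseq_LIMSEQ[OF tendsto_qpochhammer_inf[OF assms(1,2)] this]
  show "(\<lambda>n. \<Prod>i<d * n. 1 - a * q ^ i) \<longlonglongrightarrow> (a; q)\<^sub>\<infinity>"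
    by (simp add: o_def)
  have "(\<Prod>i<d * n. 1 - a * q ^ i) = (\<Prod>r<d. \<Prod>i<n. 1 - (a * q ^ r) * (q ^ d) ^ i)" for n
  proof -
    have split: "(\<Prod>i<m + d. f i) = (\<Prod>i<m. f i) * (\<Prod>r<d. f (r + m))" for f :: "nat \<Rightarrow> 'a fps" and m
      by (induction d) (simp_all add: mult.assoc add.commute)
    have "(\<Prod>i<n. \<Prod>r<d. 1 - a * q ^ (r + d * i)) = (\<Prod>i<d * n. 1 - a * q ^ i)"
    proof (induction n)
      case (Suc n)
      have "(\<Prod>i<d * Suc n. 1 - a * q ^ i) = (\<Prod>i<d * n + d. 1 - a * q ^ i)"
        by (simp add: add.commute)
      also have "\<dots> = (\<Prod>i<d * n. 1 - a * q ^ i) * (\<Prod>r<d. 1 - a * q ^ (r + d * n))"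
        by (rule split)
      finally show ?case using Suc by simp
    qed auto
    thus ?thesis
      by (subst prod.swap) (simp add: power_add power_mult mult.assoc)
  qed
  moreover have "(\<lambda>n. \<Prod>r<d. \<Prod>i<n. 1 - (a * q ^ r) * (q ^ d) ^ i)
      \<longlonglongrightarrow> (\<Prod>r<d. (a * q ^ r; q ^ d)\<^sub>\<infinity>)"
    using assms by (intro tendsto_prod_family_fps tendsto_qpochhammer_inf) auto
  ultimately show "(\<lambda>n. \<Prod>i<d * n. 1 - a * q ^ i) \<longlonglongrightarrow> (\<Prod>r<d. (a * q ^ r; q ^ d)\<^sub>\<infinity>)"
    by simp
qed

lemma qpochhammer_inf_minus:
  fixes a q :: "'a :: field fps"
  assumes "a $ 0 = 0" "q $ 0 = 0"
  shows "(a; q)\<^sub>\<infinity> * (-a; q)\<^sub>\<infinity> = (a\<^sup>2; q\<^sup>2)\<^sub>\<infinity>"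
proof (rule LIMSEQ_unique)
  show "(\<lambda>n. (\<Prod>i<n. 1 - a * q ^ i) * (\<Prod>i<n. 1 - (-a) * q ^ i))
      \<longlonglongrightarrow> (a; q)\<^sub>\<infinity> * (-a; q)\<^sub>\<infinity>"
    using assms by (intro tendsto_mult_fps tendsto_qpochhammer_inf) auto
  have "(\<Prod>i<n. 1 - a * q ^ i) * (\<Prod>i<n. 1 - (-a) * q ^ i) = (\<Prod>i<n. 1 - a\<^sup>2 * (q\<^sup>2) ^ i)" for n
    unfolding prod.distrib[symmetric]
    by (intro prod.cong refl)
       (simp add: algebra_simps power2_eq_square power_mult_distrib)
  thus "(\<lambda>n. (\<Prod>i<n. 1 - a * q ^ i) * (\<Prod>i<n. 1 - (-a) * q ^ i)) \<longlonglongrightarrow> (a\<^sup>2; q\<^sup>2)\<^sub>\<infinity>"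
    using tendsto_qpochhammer_inf[of "a\<^sup>2" "q\<^sup>2"] assms by simp
qed

text \<open>Termwise \<open>(1 - b) * (1 - w * b) * (1 - w^2 * b) = 1 - b^3\<close>, since the
  hypothesis makes \<open>w\<close> a cube root of unity whose powers 1, \<open>w\<close>,
  \<open>w^2\<close> sum to 0.\<close>

lemma qpochhammer_inf_cube:
  fixes a q :: "'a :: field fps"
  assumes "a $ 0 = 0" "q $ 0 = 0" "1 + w + w\<^sup>2 = 0"
  shows "(a; q)\<^sub>\<infinity> * (fps_const w * a; q)\<^sub>\<infinity> * (fps_const (w\<^sup>2) * a; q)\<^sub>\<infinity> = (a ^ 3; q ^ 3)\<^sub>\<infinity>"
proof (rule LIMSEQ_unique)
  let ?w = "fps_const w"
  have w: "1 + ?w + ?w\<^sup>2 = 0"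
    using assms(3) by (metis fps_const_add fps_const_power fps_const_1_eq_1 fps_const_0_eq_0)
  show "(\<lambda>n. (\<Prod>i<n. 1 - a * q ^ i) * (\<Prod>i<n. 1 - (?w * a) * q ^ i) * (\<Prod>i<n. 1 - (fps_const (w\<^sup>2) * a) * q ^ i))
      \<longlonglongrightarrow> (a; q)\<^sub>\<infinity> * (?w * a; q)\<^sub>\<infinity> * (fps_const (w\<^sup>2) * a; q)\<^sub>\<infinity>"
    using assms by (intro tendsto_mult_fps tendsto_qpochhammer_inf) auto
  have *: "(1 - b) * (1 - ?w * b) * (1 - ?w\<^sup>2 * b) = 1 - b ^ 3" for b
    using w by algebra
  have "(\<Prod>i<n. 1 - a * q ^ i) * (\<Prod>i<n. 1 - (?w * a) * q ^ i) * (\<Prod>i<n. 1 - (fps_const (w\<^sup>2) * a) * q ^ i)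
      = (\<Prod>i<n. 1 - a ^ 3 * (q ^ 3) ^ i)" for n
    unfolding prod.distrib[symmetric]
  proof (intro prod.cong refl)
    fix i
    show "(1 - a * q ^ i) * (1 - ?w * a * q ^ i) * (1 - fps_const (w\<^sup>2) * a * q ^ i)
       = 1 - a ^ 3 * (q ^ 3) ^ i"
      using *[of "a * q ^ i"]
      by (simp add: mult.assoc power_mult_distrib power_commutes fps_const_power[symmetric]
         power_mult[symmetric] mult.commute[of 3] del: fps_const_power)
  qed
  thus "(\<lambda>n. (\<Prod>i<n. 1 - a * q ^ i) * (\<Prod>i<n. 1 - (?w * a) * q ^ i) * (\<Prod>i<n. 1 - (fps_const (w\<^sup>2) * a) * q ^ i)) \<longlonglongrightarrow> (a ^ 3; q ^ 3)\<^sub>\<infinity>"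
    using tendsto_qpochhammer_inf[of "a ^ 3" "q ^ 3"] assms by simp
qed

section \<open>The generating function of \<open>PD\<close>\<close>

text \<open>The coefficient of \<open>X^(t * c)\<close> counts the designations among
  \<open>c\<close> copies of the part \<open>t\<close>: there are \<open>c\<close> of them for
  \<open>c > 0\<close>, and one empty choice if \<open>t\<close> is absent.\<close>

definition designated_part_fps :: "nat \<Rightarrow> 'a :: comm_ring_1 fps" where
  "designated_part_fps t =
     Abs_fps (\<lambda>j. if j = 0 then 1 else if t dvd j then of_nat (j div t) else 0)"

lemma designated_part_fps_eq:
  assumes "t > 0"
  shows "designated_part_fps t * (1 - fps_X ^ t)\<^sup>2 = (1 - fps_X ^ t + fps_X ^ (2 * t) :: 'a :: comm_ring_1 fps)"
proof -
  \<comment> \<open>In steps of \<open>t\<close> the coefficients are 1, 1, 2, 3, and so on. One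
    factor \<open>1 - X^t\<close> turns them into the differences 1, 0, 1, 1, and so on, which is
    \<open>H\<close>; the second one leaves 1, -1, 1, 0, and zeros from there on.\<close>
  define H :: "'a fps" where "H = Abs_fps (\<lambda>j. if j = 0 \<or> t dvd j \<and> j \<ge> 2 * t then 1 else 0)"
  have "designated_part_fps t * (1 - fps_X ^ t) = H"
  proof (rule fps_ext)
    fix j
    have "(designated_part_fps t * (1 - fps_X ^ t) :: 'a fps) $ j =
        designated_part_fps t $ j - (if j < t then 0 else designated_part_fps t $ (j - t))"
      by (simp add: right_diff_distrib fps_X_power_mult_right_nth)
    also have "\<dots> = H $ j"
    proof (cases "t dvd j")
      case True
      then obtain i where i: "j = t * i" by blast
      consider "i = 0" | "i = 1" | i' where "i = Suc (Suc i')"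
        by (metis One_nat_def not0_implies_Suc)
      thus ?thesis
      proof cases
        case 3
        have "j - t = t * Suc i'" using 3 i by simp
        thus ?thesis using i assms 3 by (simp add: designated_part_fps_def H_def)
      qed (use i assms in \<open>auto simp: designated_part_fps_def H_def\<close>)
    next
      case False
      hence "\<not> t dvd j - t" if "j \<ge> t" using that
        by (metis dvd_refl dvd_diffD)
      thus ?thesis using False assms
        by (auto simp: designated_part_fps_def H_def not_less intro!: Nat.gr0I)
    qed
    finally show "(designated_part_fps t * (1 - fps_X ^ t) :: 'a fps) $ j = H $ j" .
  qed
  moreover have "H * (1 - fps_X ^ t) = 1 - fps_X ^ t + fps_X ^ (2 * t)"
  proof (rule fps_ext)
    fix j
    have "(H * (1 - fps_X ^ t)) $ j = H $ j - (if j < t then 0 else H $ (j - t))"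
      by (simp add: right_diff_distrib fps_X_power_mult_right_nth)
    also have "\<dots> = (1 - fps_X ^ t + fps_X ^ (2 * t) :: 'a fps) $ j"
    proof (cases "t dvd j")
      case True
      then obtain i where i: "j = t * i" by blast
      consider "i = 0" | "i = 1" | "i = 2" | i' where "i = Suc (Suc (Suc i'))"
        by (metis One_nat_def not0_implies_Suc numeral_2_eq_2)
      thus ?thesis
      proof cases
        case 4
        have "j - t = t * Suc (Suc i')" using 4 i by simp
        thus ?thesis using i assms 4 by (simp add: H_def fps_X_power_nth)
      qed (use i assms in \<open>auto simp: H_def fps_X_power_nth\<close>)
    next
      case False
      hence "\<not> t dvd j - t" if "j \<ge> t" using that
        by (metis dvd_refl dvd_diffD)
      thus ?thesis using False assms
        by (auto simp: H_def not_less fps_X_power_nth intro!: Nat.gr0I)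
    qed
    finally show "(H * (1 - fps_X ^ t)) $ j = (1 - fps_X ^ t + fps_X ^ (2 * t) :: 'a fps) $ j" .
  qed
  ultimately show ?thesis
    by (simp add: power2_eq_square flip: mult.assoc)
qed

text \<open>With \<open>x = X^t\<close>, the preceding numerator satisfies
  \<open>(1 - x + x^2) * (1 + x) = 1 + x^3\<close>, and the factor \<open>1 - x^3\<close> completes
  this to \<open>1 - x^6\<close>.\<close>

lemma designated_part_fps_mult:
  assumes "t > 0"
  shows "designated_part_fps t * (1 - fps_X ^ t) * (1 - fps_X ^ (2 * t)) * (1 - fps_X ^ (3 * t)) =
    (1 - fps_X ^ (6 * t) :: 'a :: idom fps)"
proof -
  define x :: "'a fps" where "x = fps_X ^ t"
  have x: "fps_X ^ (2 * t) = x ^ 2" "fps_X ^ (3 * t) = x ^ 3" "fps_X ^ (6 * t) = x ^ 6"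
    by (simp_all add: x_def mult.commute flip: power_mult)
  have "designated_part_fps t * (1 - x) ^ 2 = 1 - x + x ^ 2"
    using designated_part_fps_eq[OF assms, where 'a = 'a] by (simp add: x x_def)
  hence "designated_part_fps t * (1 - x) * (1 - x ^ 2) * (1 - x ^ 3) = 1 - x ^ 6"
    by algebra
  thus ?thesis by (simp add: x flip: x_def)
qed

section \<open>Partitions with bounded part sizes and the product formula for
  \<open>PD\<close>\<close>

lemma finite_partitions_nat:
  "finite {p :: nat multiset. 0 \<notin># p \<and> sum_mset p = n}" (is "finite ?A")
proof (rule finite_subset)
  show "?A \<subseteq> fst ` designated_partitions n"
  proof
    fix p assume p: "p \<in> ?A"
    \<comment> \<open>Designating the first copy of every size shows that each partition is the
      projection of a designated one.\<close>
    have "(\<lambda>t\<in>set_mset p. 1) \<in> (\<Pi>\<^sub>E t\<in>set_mset p. {1..count p t})"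
      by (auto simp: Suc_le_eq)
    hence "(p, \<lambda>t\<in>set_mset p. 1) \<in> designated_partitions n"
      using p by (auto simp: designated_partitions_def)
    thus "p \<in> fst ` designated_partitions n" by force
  qed
qed (simp add: finite_designated_partitions)

lemma PD_eq_sum:
  "PD n = (\<Sum>p | 0 \<notin># p \<and> sum_mset p = n. \<Prod>t\<in>set_mset p. count p t)"
  using finite_partitions_nat[of n]
  by (simp add: PD_def designated_partitions_def card_SigmaI card_PiE finite_PiE)

text \<open>All copies of the largest admissible part \<open>Suc N\<close> are split off:
  \<open>i\<close> is the sum of the remaining parts, and the number of removed copies is
  \<open>(n - i) div Suc N\<close>. The weight of a partition is the product of its
  multiplicities.\<close>

lemma sum_bounded_partitions_Suc:
  fixes N n :: nat
  defines "W \<equiv> \<lambda>N n. {p. 0 \<notin># p \<and> sum_mset p = n \<and> set_mset p \<subseteq> {..N}}"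
  shows "(\<Sum>p\<in>W (Suc N) n. \<Prod>t\<in>set_mset p. of_nat (count p t)) =
    (\<Sum>i=0..n. (\<Sum>p\<in>W N i. \<Prod>t\<in>set_mset p. of_nat (count p t)) *
       (designated_part_fps (Suc N) :: 'a :: comm_ring_1 fps) $ (n - i))"
proof -
  obtain M where M: "M = Suc N" by simp
  have [simp]: "M \<noteq> 0" by (simp add: M)
  define w :: "nat multiset \<Rightarrow> 'a" where "w = (\<lambda>p. \<Prod>t\<in>set_mset p. of_nat (count p t))"
  define I where "I = {i \<in> {0..n}. M dvd n - i}"
  define G :: "'a fps" where "G = designated_part_fps M"
  have fin: "finite (W N i)" for N i
    by (rule finite_subset[OF _ finite_partitions_nat[of i]]) (auto simp: W_def)
  \<comment> \<open>Only those \<open>i\<close> matter for which \<open>n - i\<close> is a multiple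
    of \<open>M\<close>, as the other coefficients of \<open>G\<close> vanish.\<close>
  have "(\<Sum>i=0..n. (\<Sum>p\<in>W N i. w p) * G $ (n - i)) = (\<Sum>i\<in>I. (\<Sum>p\<in>W N i. w p) * G $ (n - i))"
  proof (rule sum.mono_neutral_right)
    show "\<forall>i\<in>{0..n} - I. sum w (W N i) * G $ (n - i) = 0"
      by (auto simp: I_def G_def designated_part_fps_def intro!: Nat.gr0I)
  qed (auto simp: I_def)
  also have "\<dots> = (\<Sum>(i, p)\<in>Sigma I (W N). w p * G $ (n - i))"
    by (subst sum.Sigma[symmetric]) (auto simp: I_def fin sum_distrib_right)
  also have "\<dots> = (\<Sum>p\<in>W M n. w p)"
  proof (rule sum.reindex_bij_witness)
    let ?j = "\<lambda>(i, p). p + replicate_mset ((n - i) div M) M"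
    let ?i = "\<lambda>p. (n - M * count p M, filter_mset (\<lambda>t. t \<noteq> M) p)"
    have count0: "count p M = 0" if "p \<in> W N i" for p i
      using that by (auto simp: W_def M count_eq_zero_iff)
    {
      fix a assume "a \<in> Sigma I (W N)"
      then obtain i p where a: "a = (i, p)" "i \<le> n" "M dvd n - i" "p \<in> W N i"
        by (auto simp: I_def)
      from a(3) obtain c where c: "n - i = M * c" by blast
      have fp: "filter_mset (\<lambda>t. t \<noteq> M) p = p"
        using a(4) by (auto simp: W_def M filter_mset_eq_conv)
      have "n - M * c = i" using c a(2) by linarith
      thus "?i (?j a) = a"
        using a count0[OF a(4)] fp by (simp add: c)
      have n: "n = i + M * c" using c a(2) by linarith
      have "sum_mset (replicate_mset c M) = M * c"
        by (simp add: sum_mset_replicate_mset)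
      thus "?j a \<in> W M n"
        using a n by (auto simp: W_def c M le_Suc_eq simp del: mult_Suc split: if_splits)
      \<comment> \<open>Adding \<open>c > 0\<close> copies of the new size multiplies the weight by
        \<open>c\<close>; for \<open>c = 0\<close> the weight is unchanged and the coefficient of
        \<open>G\<close> is 1.\<close>
      have "w (?j a) = w p * G $ (n - i)"
      proof (cases "c = 0")
        case True
        thus ?thesis using a c by (simp add: G_def designated_part_fps_def)
      next
        case False
        have notin: "M \<notin># p" using count0[OF a(4)] by (simp add: count_eq_zero_iff)
        have "w (p + replicate_mset c M) =
            (\<Prod>t\<in>insert M (set_mset p). of_nat (count (p + replicate_mset c M) t))"
          using False by (simp add: w_def)
        also have "\<dots> = of_nat c * (\<Prod>t\<in>set_mset p. of_nat (count (p + replicate_mset c M) t))"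
          using notin count0[OF a(4)] by (subst prod.insert) auto
        also have "(\<Prod>t\<in>set_mset p. of_nat (count (p + replicate_mset c M) t)) = w p"
          unfolding w_def using notin by (intro prod.cong refl) auto
        finally show ?thesis
          using a False by (simp add: c G_def designated_part_fps_def mult.commute)
      qed
      thus "w (?j a) = (case a of (i, p) \<Rightarrow> w p * G $ (n - i))"
        using a by simp
    }
    {
      fix p assume p: "p \<in> W M n"
      define c where "c = count p M"
      define p' where "p' = filter_mset (\<lambda>t. t \<noteq> M) p"
      have "filter_mset (\<lambda>t. t = M) p = replicate_mset c M"
        by (simp add: c_def filter_eq_replicate_mset)
      hence dec: "p = p' + replicate_mset c M"
        using multiset_partition[of p "\<lambda>t. t \<noteq> M"] by (simp add: p'_def)
      have "sum_mset p = sum_mset p' + M * c"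
        by (subst dec) (simp add: sum_mset_replicate_mset)
      hence n: "n = sum_mset p' + M * c" using p by (simp add: W_def)
      hence c: "(n - (n - M * c)) div M = c" by simp
      show "?j (?i p) = p"
        using c by (simp flip: c_def p'_def dec)
      have "0 \<notin># p'" "set_mset p' \<subseteq> {..N}"
        using p by (auto simp: W_def p'_def M le_Suc_eq)
      moreover have "sum_mset p' = n - M * c" using n by simp
      ultimately have "p' \<in> W N (n - M * c)" by (simp add: W_def)
      thus "?i p \<in> Sigma I (W N)"
        using n by (simp add: I_def flip: c_def p'_def)
    }
  qed
  finally show ?thesis by (simp add: w_def G_def M)
qed

lemma prod_designated_part_fps_nth:
  "(\<Prod>t=1..N. designated_part_fps t :: 'a :: comm_ring_1 fps) $ n =
     (\<Sum>p | 0 \<notin># p \<and> sum_mset p = n \<and> set_mset p \<subseteq> {..N}. \<Prod>t\<in>set_mset p. of_nat (count p t))"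
proof (induction N arbitrary: n)
  case 0
  have "{p. 0 \<notin># p \<and> sum_mset p = n \<and> set_mset p \<subseteq> {..0}} =
      (if n = 0 then {{#} :: nat multiset} else {})"
  proof -
    have "0 \<notin># p \<and> sum_mset p = n \<and> set_mset p \<subseteq> {..0} \<longleftrightarrow> n = 0 \<and> p = {#}" for p :: "nat multiset"
      by (cases p) auto
    thus ?thesis by simp
  qed
  thus ?case by simp
next
  case (Suc N)
  have "(\<Prod>t=1..Suc N. designated_part_fps t :: 'a fps) =
      (\<Prod>t=1..N. designated_part_fps t) * designated_part_fps (Suc N)"
    by simp
  thus ?case
    by (simp only: fps_mult_nth Suc.IH sum_bounded_partitions_Suc)
qed

lemma tendsto_prod_designated_part_fps:
  "(\<lambda>N. \<Prod>t=1..N. designated_part_fps t) \<longlonglongrightarrow> Abs_fps (\<lambda>n. of_nat (PD n) :: 'a :: comm_ring_1)"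
proof (rule tendsto_fpsI)
  fix n
  \<comment> \<open>No part exceeds the sum of all parts, so for \<open>N >= n\<close> the bound on
    part sizes is vacuous and coefficient \<open>n\<close> has stabilized.\<close>
  have "(\<Prod>t=1..N. designated_part_fps t :: 'a fps) $ n = of_nat (PD n)" if "N \<ge> n" for N
  proof -
    have "set_mset p \<subseteq> {..sum_mset p}" for p :: "nat multiset"
      by (auto dest!: multi_member_split)
    hence "{p. 0 \<notin># p \<and> sum_mset p = n \<and> set_mset p \<subseteq> {..N}} = {p. 0 \<notin># p \<and> sum_mset p = n}"
      using that by (intro Collect_cong) (metis atMost_subset_iff order_trans)
    thus ?thesis
      by (simp only: prod_designated_part_fps_nth PD_eq_sum of_nat_sum of_nat_prod)
  qed
  thus "\<forall>\<^sub>F N in sequentially. (\<Prod>t=1..N. designated_part_fps t) $ n =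
      Abs_fps (\<lambda>n. of_nat (PD n) :: 'a) $ n"
    unfolding eventually_sequentially by auto
qed

lemma PD_fps:
  fixes q :: "'a :: field fps"
  defines "q \<equiv> fps_X"
  shows "Abs_fps (\<lambda>n. of_nat (PD n)) * (q; q)\<^sub>\<infinity> * (q^2; q^2)\<^sub>\<infinity> * (q^3; q^3)\<^sub>\<infinity> = (q^6; q^6)\<^sub>\<infinity>"
proof (rule LIMSEQ_unique)
  have E: "(\<lambda>N. \<Prod>t=1..N. 1 - q ^ (k * t)) \<longlonglongrightarrow> (q ^ k; q ^ k)\<^sub>\<infinity>" if "k > 0" for k
  proof -
    have "(\<Prod>t=1..N. 1 - q ^ (k * t)) = (\<Prod>i<N. 1 - q ^ k * (q ^ k) ^ i)" for N
      by (induction N) (auto simp: power_add simp flip: power_mult)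
    thus ?thesis using tendsto_qpochhammer_inf[of "q ^ k" "q ^ k"] that by (simp add: q_def)
  qed
  show "(\<lambda>N. (\<Prod>t=1..N. designated_part_fps t) * (\<Prod>t=1..N. 1 - q ^ t) * (\<Prod>t=1..N. 1 - q ^ (2 * t)) * (\<Prod>t=1..N. 1 - q ^ (3 * t)))
     \<longlonglongrightarrow> Abs_fps (\<lambda>n. of_nat (PD n)) * (q; q)\<^sub>\<infinity> * (q^2; q^2)\<^sub>\<infinity> * (q^3; q^3)\<^sub>\<infinity>"
    using E[of 1] by (intro tendsto_mult_fps tendsto_prod_designated_part_fps E) simp_all
  have "(\<Prod>t=1..N. designated_part_fps t) * (\<Prod>t=1..N. 1 - q ^ t) * (\<Prod>t=1..N. 1 - q ^ (2 * t)) * (\<Prod>t=1..N. 1 - q ^ (3 * t))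
     = (\<Prod>t=1..N. 1 - q ^ (6 * t))" for N
    unfolding prod.distrib[symmetric] q_def
    by (intro prod.cong refl designated_part_fps_mult) simp
  thus "(\<lambda>N. (\<Prod>t=1..N. designated_part_fps t) * (\<Prod>t=1..N. 1 - q ^ t) * (\<Prod>t=1..N. 1 - q ^ (2 * t)) * (\<Prod>t=1..N. 1 - q ^ (3 * t)))
     \<longlonglongrightarrow> (q^6; q^6)\<^sub>\<infinity>"
    using E[of 6] by simp
qed

section \<open>The Jacobi triple product and 3-dissections\<close>

text \<open>Gaussian binomial coefficients in base \<open>p\<close>, given by a Pascal recurrence so
  that they exist in every commutative ring without division by factors \<open>1 - p^i\<close>. The
  truncated exponent \<open>n - j\<close> is harmless, since \<open>qbinomial p n j\<close> is 0 for
  \<open>j > n\<close>.\<close>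

fun qbinomial :: "'a :: comm_ring_1 \<Rightarrow> nat \<Rightarrow> nat \<Rightarrow> 'a" where
  "qbinomial p n 0 = 1"
| "qbinomial p 0 (Suc j) = 0"
| "qbinomial p (Suc n) (Suc j) = qbinomial p n (Suc j) + p ^ (n - j) * qbinomial p n j"

lemma qbinomial_eq_0: "n < j \<Longrightarrow> qbinomial p n j = 0"
  by (induction p n j rule: qbinomial.induct) auto

lemma qbinomial_mult:
  assumes "j \<le> n"
  shows "qbinomial p n j * (\<Prod>i<j. 1 - p * p ^ i) * (\<Prod>i<n - j. 1 - p * p ^ i) = (\<Prod>i<n. 1 - p * p ^ i)"
  using assms
proof (induction p n j rule: qbinomial.induct)
  case (3 p n j)
  let ?P = "\<lambda>n. \<Prod>i<n. 1 - p * p ^ i"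
  have 2: "qbinomial p n j * ?P j * ?P (n - j) = ?P n"
    using 3 by simp
  \<comment> \<open>The complementary index of \<open>Suc j\<close> is one less than
    \<open>n - j\<close>, hence the extra factor \<open>1 - p ^ (n - j)\<close>; for
    \<open>j = n\<close> both sides are 0.\<close>
  have 1: "qbinomial p n (Suc j) * ?P (Suc j) * ?P (n - j) = ?P n * (1 - p ^ (n - j))"
  proof (cases "j < n")
    case True
    then obtain m where m: "n - j = Suc m" "n - Suc j = m" by (metis Suc_diff_Suc)
    have "qbinomial p n (Suc j) * ?P (Suc j) * ?P m = ?P n"
      using 3 True m by simp
    thus ?thesis
      by (simp add: m mult.assoc[symmetric])
  next
    case False
    thus ?thesis using 3 by (simp add: qbinomial_eq_0)
  qed
  have p: "p ^ (n - j) * p ^ j = p ^ n" using 3 by (simp flip: power_add)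
  have "qbinomial p (Suc n) (Suc j) * ?P (Suc j) * ?P (n - j) =
      qbinomial p n (Suc j) * ?P (Suc j) * ?P (n - j) +
      p ^ (n - j) * (1 - p * p ^ j) * (qbinomial p n j * ?P j * ?P (n - j))"
    by (simp add: algebra_simps)
  also have "\<dots> = ?P n * (1 - p * (p ^ (n - j) * p ^ j))"
    unfolding 1 2 by (simp add: algebra_simps)
  finally show ?case by (simp add: p)
qed auto

text \<open>Induction splits off the factor \<open>y + x * p^n\<close>; its two contributions to a
  coefficient recombine by the Pascal recurrence. Homogeneity in \<open>x\<close> and
  \<open>y\<close> takes the place of a variable with negative powers.\<close>

lemma prod_homogeneous_qbinomial:
  fixes x y p :: "'a :: comm_ring_1"
  shows "(\<Prod>i<n. y + x * p ^ i) = (\<Sum>j\<le>n. p ^ (j choose 2) * qbinomial p n j * x ^ j * y ^ (n - j))"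
proof (induction n)
  case (Suc n)
  let ?f = "\<lambda>n j. p ^ (j choose 2) * qbinomial p n j * x ^ j * y ^ (n - j)"
  have "(\<Prod>i<Suc n. y + x * p ^ i) = (\<Sum>j\<le>n. ?f n j * y) + (\<Sum>j\<le>n. ?f n j * (x * p ^ n))"
    by (simp add: Suc sum_distrib_right sum.distrib distrib_left)
  also have "(\<Sum>j\<le>n. ?f n j * y) = (\<Sum>j\<le>Suc n. p ^ (j choose 2) * qbinomial p n j * x ^ j * y ^ (Suc n - j))"
    by (simp add: qbinomial_eq_0 Suc_diff_le mult_ac)
  also have "\<dots> = y ^ Suc n + (\<Sum>j\<le>n. p ^ (Suc j choose 2) * qbinomial p n (Suc j) * x ^ Suc j * y ^ (n - j))"
    by (subst sum.atMost_Suc_shift) (simp add: numeral_2_eq_2)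
  also have "(\<Sum>j\<le>n. ?f n j * (x * p ^ n)) =
      (\<Sum>j\<le>n. p ^ (Suc j choose 2) * (p ^ (n - j) * qbinomial p n j) * x ^ Suc j * y ^ (n - j))"
  proof (intro sum.cong refl)
    fix j assume "j \<in> {..n}"
    hence "p ^ n = p ^ j * p ^ (n - j)" by (simp flip: power_add)
    thus "?f n j * (x * p ^ n) = p ^ (Suc j choose 2) * (p ^ (n - j) * qbinomial p n j) * x ^ Suc j * y ^ (n - j)"
      by (simp add: numeral_2_eq_2 power_add mult_ac)
  qed
  also have "y ^ Suc n + (\<Sum>j\<le>n. p ^ (Suc j choose 2) * qbinomial p n (Suc j) * x ^ Suc j * y ^ (n - j)) +
     (\<Sum>j\<le>n. p ^ (Suc j choose 2) * (p ^ (n - j) * qbinomial p n j) * x ^ Suc j * y ^ (n - j)) =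
     y ^ Suc n + (\<Sum>j\<le>n. ?f (Suc n) (Suc j))"
    by (simp add: sum.distrib[symmetric] algebra_simps)
  also have "\<dots> = (\<Sum>j\<le>Suc n. ?f (Suc n) j)"
    by (subst sum.atMost_Suc_shift) (simp add: binomial_eq_0)
  finally show ?case .
qed (simp add: binomial_eq_0)

section \<open>Theta exponents, theta series and the finite triple product\<close>

definition theta_exponent :: "nat \<Rightarrow> nat \<Rightarrow> int \<Rightarrow> nat" where
  "theta_exponent k l m = nat (int k * (m * (m - 1) div 2) + int l * m)"

text \<open>For \<open>m >= 0\<close> the linear term alone gives \<open>m\<close>; for
  \<open>m = -r < 0\<close> the form equals \<open>k*r*(r - 1)/2 + (k - l)*r\<close>, which is at
  least \<open>r - 1\<close>. So the truncation by \<open>nat\<close> in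
  \<open>theta_exponent\<close> is harmless, and each exponent is attained only finitely
  often.\<close>

lemma theta_exponent_ge:
  assumes "0 < l" "l \<le> k"
  shows "int k * (m * (m - 1) div 2) + int l * m \<ge> \<bar>m\<bar> - 1"
    and "int k * (m * (m - 1) div 2) + int l * m \<ge> 0"
proof -
  have "int k * (m * (m - 1) div 2) + int l * m \<ge> \<bar>m\<bar> - 1 \<and> int k * (m * (m - 1) div 2) + int l * m \<ge> 0"
  proof (cases "m \<ge> 0")
    case True
    have "m * (m - 1) div 2 \<ge> 0"
      using True by (cases "m = 0") auto
    hence "int k * (m * (m - 1) div 2) \<ge> 0" by simp
    moreover have "int l * m \<ge> 1 * m"
      using True assms by (intro mult_right_mono) auto
    ultimately show ?thesis using True by linarith
  next
    case False
    define r where "r = - m"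
    have r: "r \<ge> 1" using False by (simp add: r_def)
    have "m * (m - 1) = r * (r - 1) + r * 2"
      by (simp add: r_def algebra_simps)
    hence eq: "m * (m - 1) div 2 = r * (r - 1) div 2 + r"
      by simp
    have "(r - 2) * (r - 1) \<ge> 0" using r by (cases "r = 1") auto
    hence "r * (r - 1) \<ge> 2 * (r - 1)" by (simp add: algebra_simps)
    hence ge: "r * (r - 1) div 2 \<ge> r - 1"
      using zdiv_mono1[of "2 * (r - 1)" "r * (r - 1)" 2] by simp
    have "int l * r \<le> int k * r" using assms r by (intro mult_right_mono) auto
    moreover have "1 * (r * (r - 1) div 2) \<le> int k * (r * (r - 1) div 2)"
      using assms r ge by (intro mult_right_mono) auto
    moreover have "int k * (m * (m - 1) div 2) + int l * m = int k * (r * (r - 1) div 2) + int k * r - int l * r"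
      by (simp add: eq distrib_left) (simp add: r_def)
    moreover have "\<bar>m\<bar> = r" "int l * m = - (int l * r)" using r by (auto simp: r_def)
    ultimately show ?thesis using ge r by linarith
  qed
  thus "int k * (m * (m - 1) div 2) + int l * m \<ge> \<bar>m\<bar> - 1"
    and "int k * (m * (m - 1) div 2) + int l * m \<ge> 0" by auto
qed

lemma int_theta_exponent:
  assumes "0 < l" "l \<le> k"
  shows "int (theta_exponent k l m) = int k * (m * (m - 1) div 2) + int l * m"
  using theta_exponent_ge(2)[OF assms] by (simp add: theta_exponent_def)

lemma abs_le_theta_exponent:
  assumes "0 < l" "l \<le> k"
  shows "nat \<bar>m\<bar> \<le> theta_exponent k l m + 1"
  using theta_exponent_ge(1)[OF assms, of m] int_theta_exponent[OF assms, of m] by linarith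

lemma finite_theta_exponent_eq:
  assumes "0 < l" "l \<le> k"
  shows "finite {m. theta_exponent k l m = n}"
proof (rule finite_subset)
  show "{m. theta_exponent k l m = n} \<subseteq> {- int n - 1..int n + 1}"
  proof
    fix m assume "m \<in> {m. theta_exponent k l m = n}"
    thus "m \<in> {- int n - 1..int n + 1}" using abs_le_theta_exponent[OF assms, of m] by simp linarith
  qed
qed simp

text \<open>
  \<open>theta_fps k l s\<close> is \<open>\<Sum>\<^sub>m s\<^sup>m X\<^sup>e\<^sup>(\<^sup>m\<^sup>)\<close> over all integers \<open>m\<close> with
  \<open>e(m) = k m (m - 1) / 2 + l m\<close>. It is only used for \<open>s\<^sup>2 = 1\<close>, where \<open>s\<^sup>m = s ^ nat \<bar>m\<bar>\<close>.
\<close>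

definition theta_fps :: "nat \<Rightarrow> nat \<Rightarrow> 'a \<Rightarrow> 'a :: comm_ring_1 fps" where
  "theta_fps k l s = Abs_fps (\<lambda>n. \<Sum>m | theta_exponent k l m = n. s ^ nat \<bar>m\<bar>)"

text \<open>
  The finite triple product is the \<open>q\<close>-binomial theorem for \<open>2n\<close> factors at \<open>x = s X\<^sup>l\<close>,
  \<open>y = X\<^sup>k\<^sup>n\<close>: no negative powers of \<open>X\<close> occur, and both sides share the factor \<open>s\<^sup>n X\<^sup>M\<close>.
\<close>

lemma triple_product_finite:
  fixes s :: "'a :: field"
  assumes s: "s * s = 1" and l: "0 < l" "l \<le> k"
  defines "X \<equiv> fps_X :: 'a fps" and "S \<equiv> fps_const s"
  shows "(\<Prod>i<n. (1 + S * X ^ (k - l) * (X ^ k) ^ i) * (1 + S * X ^ l * (X ^ k) ^ i)) =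
    (\<Sum>j\<le>2*n. S ^ nat \<bar>int j - int n\<bar> * X ^ theta_exponent k l (int j - int n) * qbinomial (X ^ k) (2 * n) j)"
    (is "?L = ?R")
proof -
  define M where "M = k * (n choose 2) + l * n + k * n * n"
  have SS: "S * S = 1" using s by (simp add: S_def)
  have "S ^ n * S ^ n = 1"
    using SS by (simp flip: power_mult_distrib)
  hence nz: "S ^ n * X ^ M \<noteq> 0"
    by (metis X_def fps_X_neq_zero mult_eq_0_iff power_not_zero zero_neq_one)
  have "(\<Prod>i<2*n. X ^ (k * n) + (S * X ^ l) * (X ^ k) ^ i) =
      (\<Prod>i<n. X ^ (k * n) + (S * X ^ l) * (X ^ k) ^ i) * (\<Prod>i<n. X ^ (k * n) + (S * X ^ l) * (X ^ k) ^ (i + n))"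
  proof -
    have split: "(\<Prod>i<m + d. f i) = (\<Prod>i<m. f i) * (\<Prod>r<d. f (r + m))" for f :: "nat \<Rightarrow> 'a fps" and m d
      by (induction d) (simp_all add: mult.assoc add.commute)
    show ?thesis using split[of _ n n] by (simp add: mult_2)
  qed
  \<comment> \<open>In the first half \<open>S * X^l * X^(k*i)\<close> is pulled out, using
    \<open>S * S = 1\<close> and \<open>k*n = (l + k*i) + (k - l + k*d)\<close> with
    \<open>d = n - 1 - i\<close>; in the second half \<open>X^(k*n)\<close> is pulled out
    instead.\<close>
  also have "(\<Prod>i<n. X ^ (k * n) + (S * X ^ l) * (X ^ k) ^ i) =
      (\<Prod>i<n. S * X ^ l * (X ^ k) ^ i * (1 + S * X ^ (k - l) * (X ^ k) ^ (n - Suc i)))"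
  proof (intro prod.cong refl)
    fix i assume "i \<in> {..<n}"
    then obtain d where d: "n = Suc (i + d)" by (auto simp: less_iff_Suc_add)
    define u v where "u = X ^ l * (X ^ k) ^ i" and "v = X ^ (k - l) * (X ^ k) ^ d"
    have "k * n = l + k * i + (k - l + k * d)"
      using l by (simp add: d algebra_simps)
    hence uv: "X ^ (k * n) = u * v"
      by (simp add: u_def v_def power_add power_mult mult.assoc)
    have "u * v + S * u = S * u * (1 + S * v)" using SS by algebra
    thus "X ^ (k * n) + (S * X ^ l) * (X ^ k) ^ i =
        S * X ^ l * (X ^ k) ^ i * (1 + S * X ^ (k - l) * (X ^ k) ^ (n - Suc i))"
      unfolding uv by (simp add: d u_def v_def mult.assoc)
  qed
  also have "\<dots> = (\<Prod>i<n. S * X ^ l * (X ^ k) ^ i) * (\<Prod>i<n. 1 + S * X ^ (k - l) * (X ^ k) ^ (n - Suc i))"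
    by (simp add: prod.distrib)
  also have "(\<Prod>i<n. S * X ^ l * (X ^ k) ^ i) = S ^ n * X ^ (l * n + k * (n choose 2))"
    by (induction n) (simp_all add: numeral_2_eq_2 algebra_simps flip: power_mult power_add)
  also have "(\<Prod>i<n. 1 + S * X ^ (k - l) * (X ^ k) ^ (n - Suc i)) = (\<Prod>i<n. 1 + S * X ^ (k - l) * (X ^ k) ^ i)"
    by (rule prod.nat_diff_reindex)
  also have "(\<Prod>i<n. X ^ (k * n) + (S * X ^ l) * (X ^ k) ^ (i + n)) =
      (\<Prod>i<n. X ^ (k * n) * (1 + S * X ^ l * (X ^ k) ^ i))"
    by (intro prod.cong refl) (simp add: algebra_simps power_add flip: power_mult)
  also have "\<dots> = X ^ (k * n * n) * (\<Prod>i<n. 1 + S * X ^ l * (X ^ k) ^ i)"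
    by (simp add: prod.distrib flip: power_mult)
  finally have "(\<Prod>i<2*n. X ^ (k * n) + (S * X ^ l) * (X ^ k) ^ i) = S ^ n * X ^ M * ?L"
    by (simp add: M_def prod.distrib power_add mult_ac)
  moreover have "(\<Prod>i<2*n. X ^ (k * n) + (S * X ^ l) * (X ^ k) ^ i) = S ^ n * X ^ M * ?R"
    unfolding prod_homogeneous_qbinomial sum_distrib_left
  proof (intro sum.cong refl)
    fix j assume j: "j \<in> {..2*n}"
    define m where "m = int j - int n"
    have half: "2 * (a * (a - 1) div 2) = a * (a - 1)" for a :: int
      by (intro dvd_mult_div_cancel) auto
    have ch: "int (i choose 2) = int i * (int i - 1) div 2" for i
      by (cases i) (simp_all add: choose_two zdiv_int algebra_simps)
    \<comment> \<open>Both exponents are doubled so that the halves \<open>a * (a - 1) div 2\<close>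
      become polynomials and the comparison is plain algebra.\<close>
    have "2 * int (k * (j choose 2) + l * j + k * n * (2 * n - j)) = 2 * int (M + theta_exponent k l m)"
    proof -
      have "int (2 * n - j) = 2 * int n - int j" using j by (simp add: of_nat_diff)
      hence "2 * int (k * (j choose 2) + l * j + k * n * (2 * n - j)) =
          2 * (int k * (int j * (int j - 1) div 2) + int l * int j + int k * int n * (2 * int n - int j))"
        by (simp only: of_nat_add of_nat_mult ch)
      also have "\<dots> =
          int k * (2 * (int j * (int j - 1) div 2)) + 2 * (int l * int j + int k * int n * (2 * int n - int j))"
        by (simp only: distrib_left mult.left_commute[of 2] add.assoc)
      also have "\<dots> = int k * (2 * (int n * (int n - 1) div 2)) + 2 * (int l * int n + int k * int n * int n)
          + (int k * (2 * (m * (m - 1) div 2)) + 2 * (int l * m))"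
        unfolding half by (simp add: m_def algebra_simps)
      also have "\<dots> = 2 * int (M + theta_exponent k l m)"
        by (simp add: M_def ch int_theta_exponent[OF l] algebra_simps)
      finally show ?thesis .
    qed
    moreover have "2 * int a = 2 * int b \<Longrightarrow> a = b" for a b by simp
    ultimately have e: "k * (j choose 2) + l * j + k * n * (2 * n - j) = M + theta_exponent k l m"
      by blast
    \<comment> \<open>As \<open>S * S = 1\<close>, only the parity of the exponent matters, so the
      absolute value may replace the signed difference \<open>j - n\<close>.\<close>
    have sj: "S ^ j = S ^ n * S ^ nat \<bar>m\<bar>"
    proof (cases "j \<ge> n")
      case True
      thus ?thesis by (simp add: m_def nat_diff_distrib flip: power_add)
    next
      case False
      hence "S ^ n = S ^ j * S ^ nat \<bar>m\<bar>" by (simp add: m_def nat_diff_distrib flip: power_add)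
      moreover have "S ^ nat \<bar>m\<bar> * S ^ nat \<bar>m\<bar> = 1" using SS by (simp flip: power_mult_distrib)
      ultimately show ?thesis by (simp add: mult.assoc)
    qed
    have "(X ^ k) ^ (j choose 2) * qbinomial (X ^ k) (2 * n) j * (S * X ^ l) ^ j * (X ^ (k * n)) ^ (2 * n - j) =
        S ^ j * X ^ (k * (j choose 2) + l * j + k * n * (2 * n - j)) * qbinomial (X ^ k) (2 * n) j"
      by (simp only: power_mult_distrib power_add power_mult) (simp only: mult_ac)
    also have "\<dots> = S ^ n * X ^ M * (S ^ nat \<bar>m\<bar> * X ^ theta_exponent k l m * qbinomial (X ^ k) (2 * n) j)"
      unfolding e sj by (simp only: power_add mult_ac)
    finally show "(X ^ k) ^ (j choose 2) * qbinomial (X ^ k) (2 * n) j * (S * X ^ l) ^ j * (X ^ (k * n)) ^ (2 * n - j) =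
        S ^ n * X ^ M * (S ^ nat \<bar>int j - int n\<bar> * X ^ theta_exponent k l (int j - int n) * qbinomial (X ^ k) (2 * n) j)"
      by (simp add: m_def)
  qed
  ultimately have "S ^ n * X ^ M * ?L = S ^ n * X ^ M * ?R" by (simp only:)
  thus ?thesis by (rule iffD1[OF mult_left_cancel[OF nz]])
qed

section \<open>Passage to the limit in the finite triple product\<close>

lemma fps_X_power_dvd_iff:
  fixes f :: "'a :: field fps"
  shows "fps_X ^ n dvd f \<longleftrightarrow> (\<forall>i<n. f $ i = 0)"
proof
  assume "fps_X ^ n dvd f"
  thus "\<forall>i<n. f $ i = 0" by (auto simp: dvd_def fps_X_power_mult_nth)
next
  assume "\<forall>i<n. f $ i = 0"
  hence "f = fps_X ^ n * Abs_fps (\<lambda>i. f $ (i + n))"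
    by (intro fps_ext) (auto simp: fps_X_power_mult_nth)
  thus "fps_X ^ n dvd f" by (rule dvdI)
qed

text \<open>With \<open>P a\<close> for the product of the first \<open>a\<close> factors, the
  coefficient is \<open>P (2*n) / (P j * P (2*n - j))\<close>, and each \<open>P a\<close> agrees
  with the infinite product modulo \<open>X^(a + 1)\<close>. The smaller of the two lower indices
  therefore limits the accuracy.\<close>

lemma qbinomial_mult_qpochhammer_inf:
  fixes k j n :: nat
  assumes k: "k > 0" and j: "j \<le> 2 * n"
  defines "p \<equiv> fps_X ^ k :: 'a :: field fps"
  shows "fps_X ^ (min j (2 * n - j) + 1) dvd qbinomial p (2 * n) j * (p; p)\<^sub>\<infinity> - 1"
proof -
  define P where "P = (\<lambda>n. \<Prod>i<n. 1 - p * p ^ i)"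
  define E where "E = (p; p)\<^sub>\<infinity>"
  define r where "r = min j (2 * n - j) + 1"
  have p0: "p $ 0 = 0" using k by (simp add: p_def)
  have PE: "fps_X ^ (a + 1) dvd P a - E" for a
  proof -
    have "fps_X ^ (a + 1) dvd P a - P b" if "a \<le> b" for b
      using that
    proof (induction b rule: dec_induct)
      case (step b)
      have "p * p ^ b = fps_X ^ (k * (b + 1))" by (simp add: p_def flip: power_mult power_add)
      moreover have "a + 1 \<le> k * (b + 1)"
        using step k mult_le_mono[of 1 k "a + 1" "b + 1"] by simp
      ultimately have "fps_X ^ (a + 1) dvd P b * (p * p ^ b)"
        by (simp only: le_imp_power_dvd dvd_mult)
      from dvd_add[OF step.IH this] show ?case
        by (simp add: P_def algebra_simps)
    qed simp
    hence ab: "P b $ i = P a $ i" if "a \<le> b" "i < a + 1" for b i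
      using that unfolding fps_X_power_dvd_iff fps_sub_nth by (metis eq_iff_diff_eq_0)
    have "P \<longlonglongrightarrow> E"
      unfolding P_def E_def by (intro tendsto_qpochhammer_inf p0)
    hence "P a $ i = E $ i" if "i < a + 1" for i
      unfolding tendsto_fps_iff eventually_sequentially using ab[OF _ that]
      by (metis nle_le)
    thus ?thesis unfolding fps_X_power_dvd_iff fps_sub_nth by simp
  qed
  have rE: "fps_X ^ r dvd P a - E" if "r \<le> a + 1" for a
    using PE[of a] that by (meson dvd_trans le_imp_power_dvd)
  define B where "B = qbinomial p (2 * n) j"
  have B: "B * P j * P (2 * n - j) = P (2 * n)"
    unfolding B_def P_def by (rule qbinomial_mult[OF j])
  have 1: "fps_X ^ r dvd P j - E" "fps_X ^ r dvd P (2 * n - j) - E" "fps_X ^ r dvd P (2 * n) - E"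
    by (rule rE, use j in \<open>simp add: r_def\<close>)+
  \<comment> \<open>This writes the error, times the unit \<open>E^2\<close>, as a combination of
    the three differences between partial and full products, each divisible by
    \<open>X^r\<close>.\<close>
  have E2: "(B * E - 1) * E\<^sup>2 = E * (z - E) - B * E * (x - E) * y - B * E * E * (y - E)"
    if "B * x * y = z" for x y z
    unfolding that[symmetric] by (simp add: algebra_simps power2_eq_square)
  have "(B * E - 1) * E\<^sup>2 = E * (P (2 * n) - E) - B * E * (P j - E) * P (2 * n - j) - B * E * E * (P (2 * n - j) - E)"
    by (rule E2[OF B])
  also have "fps_X ^ r dvd \<dots>"
    by (rule dvd_diff[OF dvd_diff[OF dvd_mult[OF 1(3)] dvd_mult2[OF dvd_mult[OF 1(1)]]] dvd_mult[OF 1(2)]])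
  finally have dvd: "fps_X ^ r dvd (B * E - 1) * E\<^sup>2" .
  have "E\<^sup>2 $ 0 = 1"
    using qpochhammer_inf_nth_0[OF p0 p0] by (simp add: E_def power2_eq_square)
  hence "E\<^sup>2 dvd 1" by simp
  with dvd have "fps_X ^ r dvd B * E - 1" by (metis dvd_mult_unit_iff)
  thus ?thesis by (simp add: r_def B_def E_def)
qed

text \<open>After multiplication by the infinite product, the Gaussian coefficients of the finite
  identity tend to 1, and the growth of the theta exponent makes the total error uniform in the
  summation index. The case \<open>l = k\<close> is included for the theta series of psi.\<close>

lemma tendsto_triple_product:
  fixes s :: "'a :: field"
  assumes s: "s * s = 1" and l: "0 < l" "l \<le> k"
  defines "X \<equiv> fps_X :: 'a fps" and "S \<equiv> fps_const s"
  shows "(\<lambda>n. (\<Prod>i<n. (1 + S * X ^ (k - l) * (X ^ k) ^ i) * (1 + S * X ^ l * (X ^ k) ^ i)) * (X ^ k; X ^ k)\<^sub>\<infinity>)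
    \<longlonglongrightarrow> theta_fps k l s"
proof (rule tendsto_fpsI)
  fix N
  let ?F = "\<lambda>n. (\<Prod>i<n. (1 + S * X ^ (k - l) * (X ^ k) ^ i) * (1 + S * X ^ l * (X ^ k) ^ i)) * (X ^ k; X ^ k)\<^sub>\<infinity>"
  let ?e = "theta_exponent k l"
  have "?F n $ N = theta_fps k l s $ N" if n: "n \<ge> N + 1" for n
  proof -
    have "?F n = (\<Sum>j\<le>2*n. S ^ nat \<bar>int j - int n\<bar> * X ^ ?e (int j - int n) * (qbinomial (X ^ k) (2 * n) j * (X ^ k; X ^ k)\<^sub>\<infinity>))"
      unfolding X_def S_def triple_product_finite[OF s l] sum_distrib_right by (simp only: mult.assoc)
    hence "?F n $ N = (\<Sum>j\<le>2*n. (S ^ nat \<bar>int j - int n\<bar> * X ^ ?e (int j - int n) * (qbinomial (X ^ k) (2 * n) j * (X ^ k; X ^ k)\<^sub>\<infinity>)) $ N)"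
      by (simp add: fps_sum_nth)
    also have "\<dots> = (\<Sum>j\<le>2*n. if ?e (int j - int n) = N then s ^ nat \<bar>int j - int n\<bar> else 0)"
    proof (intro sum.cong refl)
      fix j assume j: "j \<in> {..2*n}"
      define m where "m = int j - int n"
      define Z where "Z = qbinomial (X ^ k) (2 * n) j * (X ^ k; X ^ k)\<^sub>\<infinity> - 1"
      have "X ^ (min j (2 * n - j) + 1) dvd Z"
        unfolding Z_def X_def using j l by (intro qbinomial_mult_qpochhammer_inf) auto
      hence "X ^ (?e m + (min j (2 * n - j) + 1)) dvd X ^ ?e m * Z"
        unfolding power_add by (rule mult_dvd_mono[OF dvd_refl])
      \<comment> \<open>Here \<open>min j (2*n - j) = n - |m|\<close>, while the theta exponent is
        at least \<open>|m| - 1\<close>. So the error starts at degree \<open>n > N\<close> or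
        later, however far \<open>m\<close> is from 0.\<close>
      moreover have "n \<le> ?e m + (min j (2 * n - j) + 1)"
        using abs_le_theta_exponent[OF l, of m] j by (auto simp: m_def min_def)
      ultimately have "X ^ n dvd X ^ ?e m * Z" by (meson dvd_trans le_imp_power_dvd)
      hence "(X ^ ?e m * Z) $ N = 0"
        using n by (simp add: X_def fps_X_power_dvd_iff)
      moreover define c where "c = s ^ nat \<bar>m\<bar>"
      moreover have "fps_const c * X ^ ?e m * (Z + 1) = fps_const c * (X ^ ?e m * Z) + fps_const c * X ^ ?e m"
        by (simp only: distrib_left mult.assoc mult_1_right)
      ultimately have "(fps_const c * X ^ ?e m * (Z + 1)) $ N = (if ?e m = N then c else 0)"
        by (simp add: X_def)
      moreover have "S ^ nat \<bar>m\<bar> = fps_const c"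
        by (simp add: S_def c_def)
      ultimately have "(S ^ nat \<bar>m\<bar> * X ^ ?e m * (Z + 1)) $ N = (if ?e m = N then s ^ nat \<bar>m\<bar> else 0)"
        by (simp only: c_def)
      thus "(S ^ nat \<bar>int j - int n\<bar> * X ^ ?e (int j - int n) * (qbinomial (X ^ k) (2 * n) j * (X ^ k; X ^ k)\<^sub>\<infinity>)) $ N =
          (if ?e (int j - int n) = N then s ^ nat \<bar>int j - int n\<bar> else 0)"
        unfolding Z_def m_def by (simp only: diff_add_cancel)
    qed
    also have "\<dots> = (\<Sum>j | j \<le> 2 * n \<and> ?e (int j - int n) = N. s ^ nat \<bar>int j - int n\<bar>)"
      by (subst sum.inter_filter[symmetric]) auto
    also have "\<dots> = (\<Sum>m | ?e m = N. s ^ nat \<bar>m\<bar>)"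
    proof (rule sum.reindex_bij_witness[where i = "\<lambda>m. nat (m + int n)" and j = "\<lambda>j. int j - int n"])
      fix m assume m: "m \<in> {m. ?e m = N}"
      hence "\<bar>m\<bar> \<le> int n" using abs_le_theta_exponent[OF l, of m] n by simp
      thus "int (nat (m + int n)) - int n = m" "nat (m + int n) \<in> {j. j \<le> 2 * n \<and> ?e (int j - int n) = N}"
        using m by auto
    qed auto
    finally show ?thesis by (simp add: theta_fps_def)
  qed
  thus "\<forall>\<^sub>F n in sequentially. ?F n $ N = theta_fps k l s $ N"
    unfolding eventually_sequentially by blast
qed

text \<open>For \<open>l < k\<close> both \<open>X^(k - l)\<close> and \<open>X^l\<close> have
  constant term 0, so the two finite products converge separately.\<close>

lemma triple_product:
  fixes s :: "'a :: field"
  assumes s: "s * s = 1" and l: "0 < l" "l < k"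
  defines "X \<equiv> fps_X :: 'a fps" and "S \<equiv> fps_const s"
  shows "theta_fps k l s = (- (S * X ^ (k - l)); X ^ k)\<^sub>\<infinity> * (- (S * X ^ l); X ^ k)\<^sub>\<infinity> * (X ^ k; X ^ k)\<^sub>\<infinity>"
proof (rule LIMSEQ_unique)
  show "(\<lambda>n. (\<Prod>i<n. (1 + S * X ^ (k - l) * (X ^ k) ^ i) * (1 + S * X ^ l * (X ^ k) ^ i)) * (X ^ k; X ^ k)\<^sub>\<infinity>)
    \<longlonglongrightarrow> theta_fps k l s"
    unfolding X_def S_def using assms by (intro tendsto_triple_product) auto
  have "(\<lambda>n. (\<Prod>i<n. 1 - (- (S * X ^ (k - l))) * (X ^ k) ^ i) * (\<Prod>i<n. 1 - (- (S * X ^ l)) * (X ^ k) ^ i) * (X ^ k; X ^ k)\<^sub>\<infinity>)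
    \<longlonglongrightarrow> (- (S * X ^ (k - l)); X ^ k)\<^sub>\<infinity> * (- (S * X ^ l); X ^ k)\<^sub>\<infinity> * (X ^ k; X ^ k)\<^sub>\<infinity>"
    using l by (intro tendsto_mult_fps tendsto_qpochhammer_inf tendsto_const) (auto simp: X_def)
  thus "(\<lambda>n. (\<Prod>i<n. (1 + S * X ^ (k - l) * (X ^ k) ^ i) * (1 + S * X ^ l * (X ^ k) ^ i)) * (X ^ k; X ^ k)\<^sub>\<infinity>)
    \<longlonglongrightarrow> (- (S * X ^ (k - l)); X ^ k)\<^sub>\<infinity> * (- (S * X ^ l); X ^ k)\<^sub>\<infinity> * (X ^ k; X ^ k)\<^sub>\<infinity>"
    by (simp add: prod.distrib)
qed

text \<open>At \<open>l = k\<close> the factors \<open>1 + (X^k)^i\<close> begin with the constant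
  2. Pulling it out leaves a copy of the other product, hence the square; the two finite products
  then differ in length by one, so the limit is taken at \<open>Suc n\<close>.\<close>

lemma triple_product_diagonal:
  fixes k :: nat
  assumes k: "0 < k"
  defines "X \<equiv> fps_X :: 'a :: field fps"
  shows "theta_fps k k 1 = 2 * (- (X ^ k); X ^ k)\<^sub>\<infinity> ^ 2 * (X ^ k; X ^ k)\<^sub>\<infinity>"
proof (rule LIMSEQ_unique)
  let ?F = "\<lambda>n. (\<Prod>i<n. (1 + (X ^ k) ^ i) * (1 + X ^ k * (X ^ k) ^ i)) * (X ^ k; X ^ k)\<^sub>\<infinity>"
  show "(\<lambda>n. ?F (Suc n)) \<longlonglongrightarrow> theta_fps k k 1"
    using tendsto_triple_product[of "1 :: 'a" k k] k unfolding X_def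
    by (intro LIMSEQ_Suc) simp
  let ?P = "\<lambda>n. \<Prod>i<n. 1 - (- (X ^ k)) * (X ^ k) ^ i"
  have lim: "?P \<longlonglongrightarrow> (- (X ^ k); X ^ k)\<^sub>\<infinity>"
    using k by (intro tendsto_qpochhammer_inf) (auto simp: X_def)
  have "(\<lambda>n. 2 * (?P n * ?P (Suc n)) * (X ^ k; X ^ k)\<^sub>\<infinity>) \<longlonglongrightarrow>
      2 * ((- (X ^ k); X ^ k)\<^sub>\<infinity> * (- (X ^ k); X ^ k)\<^sub>\<infinity>) * (X ^ k; X ^ k)\<^sub>\<infinity>"
    by (intro tendsto_mult_fps tendsto_const lim LIMSEQ_Suc[OF lim])
  moreover have "2 * (?P n * ?P (Suc n)) * (X ^ k; X ^ k)\<^sub>\<infinity> = ?F (Suc n)" for n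
  proof -
    have "(\<Prod>i<Suc n. 1 + (X ^ k) ^ i) = 2 * ?P n"
      by (subst prod.lessThan_Suc_shift) simp
    moreover have "(\<Prod>i<Suc n. 1 + X ^ k * (X ^ k) ^ i) = ?P (Suc n)" by simp
    ultimately show ?thesis
      by (simp only: prod.distrib mult.assoc)
  qed
  ultimately show "(\<lambda>n. ?F (Suc n)) \<longlonglongrightarrow> 2 * (- (X ^ k); X ^ k)\<^sub>\<infinity> ^ 2 * (X ^ k; X ^ k)\<^sub>\<infinity>"
    by (simp only: power2_eq_square)
qed

section \<open>3-dissections of the theta series phi and psi\<close>

lemma sum_int_mod_3:
  fixes f :: "int \<Rightarrow> 'a :: comm_monoid_add"
  assumes "finite A"
  shows "(\<Sum>m\<in>A. f m) = (\<Sum>m | 3 * m \<in> A. f (3 * m)) + (\<Sum>m | 3 * m + 1 \<in> A. f (3 * m + 1))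
     + (\<Sum>m | 3 * m - 1 \<in> A. f (3 * m - 1))"
proof -
  define B where "B = (\<lambda>r. (\<lambda>m. 3 * m + r) ` {m. 3 * m + r \<in> A})"
  have BA: "B r = {m \<in> A. (m - r) mod 3 = 0}" for r
  proof (intro equalityI subsetI)
    fix x assume "x \<in> {m \<in> A. (m - r) mod 3 = 0}"
    hence "x = 3 * ((x - r) div 3) + r" "x \<in> A" by auto
    thus "x \<in> B r" unfolding B_def by (intro image_eqI) auto
  qed (auto simp: B_def)
  have fin: "finite (B r)" for r using assms by (simp add: BA)
  have sum: "(\<Sum>m\<in>B r. f m) = (\<Sum>m | 3 * m + r \<in> A. f (3 * m + r))" for r
    unfolding B_def by (subst sum.reindex) (auto simp: inj_on_def)
  have "A = B 0 \<union> B 1 \<union> B (-1)"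
    unfolding BA by (auto, presburger)
  moreover have disj: "B 0 \<inter> B 1 = {}" "(B 0 \<union> B 1) \<inter> B (-1) = {}"
    unfolding BA by (auto, presburger+)
  ultimately have "(\<Sum>m\<in>A. f m) = (\<Sum>m\<in>B 0 \<union> B 1 \<union> B (-1). f m)" by simp
  also have "\<dots> = (\<Sum>m\<in>B 0 \<union> B 1. f m) + (\<Sum>m\<in>B (-1). f m)"
    using fin disj by (intro sum.union_disjoint) auto
  also have "(\<Sum>m\<in>B 0 \<union> B 1. f m) = (\<Sum>m\<in>B 0. f m) + (\<Sum>m\<in>B 1. f m)"
    using fin disj by (intro sum.union_disjoint) auto
  finally show ?thesis by (simp add: sum)
qed

lemma fps_compose_X_power_nth:
  fixes f :: "'a :: comm_ring_1 fps"
  assumes "k > 0"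
  shows "(f oo fps_X ^ k) $ n = (if k dvd n then f $ (n div k) else 0)"
proof -
  have "(f oo fps_X ^ k) $ n = (\<Sum>i\<in>{0..n}. if n = k * i then f $ i else 0)"
    by (auto simp: fps_compose_nth fps_X_power_nth simp flip: power_mult intro!: sum.cong)
  also have "\<dots> = (\<Sum>i\<in>(if k dvd n then {n div k} else {}). f $ i)"
    using assms by (intro sum.mono_neutral_cong_right) (auto split: if_splits)
  finally show ?thesis by simp
qed

lemma theta_fps_dilate_nth:
  "(fps_X ^ c * (theta_fps k l s oo fps_X ^ 3)) $ n =
     (\<Sum>m | c + 3 * theta_exponent k l m = n. s ^ nat \<bar>m\<bar>)"
proof -
  have "{m. c + 3 * theta_exponent k l m = n} =
      (if n < c \<or> \<not> 3 dvd n - c then {} else {m. theta_exponent k l m = (n - c) div 3})"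
    by auto
  thus ?thesis
    by (simp add: fps_X_power_mult_nth fps_compose_X_power_nth theta_fps_def)
qed

lemma power_nat_abs_involution:
  assumes "s * s = (1 :: 'a :: comm_ring_1)"
  shows "s ^ nat \<bar>m\<bar> = (if even m then 1 else s)"
proof -
  have "s ^ n = (if even n then 1 else s)" for n
    using assms by (induction n) auto
  thus ?thesis by (simp add: even_nat_iff)
qed

text \<open>The exponent is \<open>m^2\<close>, so the series is \<open>phi(q)\<close> for
  \<open>s = 1\<close> and \<open>phi(-q)\<close> for \<open>s = -1\<close>. Multiples of 3 give
  exponents divisible by 3, while \<open>3*m + 1\<close> and its negative both give
  \<open>1 + 3*(3*m^2 + 2*m)\<close>, hence the factor 2; the change of parity from \<open>m\<close>
  to \<open>3*m + 1\<close> gives the factor \<open>s\<close>.\<close>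

lemma theta_fps_2_1_dissection:
  fixes s :: "'a :: field"
  assumes s: "s * s = 1"
  shows "theta_fps 2 1 s = (theta_fps 6 3 s oo fps_X ^ 3) + 2 * fps_const s * fps_X * (theta_fps 6 5 s oo fps_X ^ 3)"
proof (rule fps_ext)
  fix n
  note pw = power_nat_abs_involution[OF s]
  define h where "h = (\<lambda>m :: int. m * (m - 1) div 2)"
  have half: "2 * h m = m * m - m" for m
    unfolding h_def by (subst dvd_mult_div_cancel) (auto simp: algebra_simps)
  have h: "int (theta_exponent k l m) = int k * h m + int l * m" if "0 < l" "l \<le> k" for k l m
    using int_theta_exponent[OF that] by (simp add: h_def)
  have e: "int (theta_exponent 2 1 m) = m * m" "2 * int (theta_exponent 6 3 m) = 6 * m * m"
    "2 * int (theta_exponent 6 5 m) = 6 * m * m + 4 * m" for m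
    using half[of m] by (simp_all add: h algebra_simps)
  have i: "theta_exponent 2 1 (3 * m) = 0 + 3 * theta_exponent 6 3 m"
     "theta_exponent 2 1 (3 * m + 1) = 1 + 3 * theta_exponent 6 5 m"
     "theta_exponent 2 1 (3 * - m - 1) = 1 + 3 * theta_exponent 6 5 m" for m
  proof -
    have "int (theta_exponent 2 1 (3 * m)) = int (0 + 3 * theta_exponent 6 3 m)"
      "int (theta_exponent 2 1 (3 * m + 1)) = int (1 + 3 * theta_exponent 6 5 m)"
      "int (theta_exponent 2 1 (3 * - m - 1)) = int (1 + 3 * theta_exponent 6 5 m)"
      using e(2,3)[of m] unfolding e(1) by (simp_all add: algebra_simps)
    thus "theta_exponent 2 1 (3 * m) = 0 + 3 * theta_exponent 6 3 m"
     "theta_exponent 2 1 (3 * m + 1) = 1 + 3 * theta_exponent 6 5 m"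
     "theta_exponent 2 1 (3 * - m - 1) = 1 + 3 * theta_exponent 6 5 m"
      by (simp_all only: of_nat_eq_iff)
  qed
  have "theta_fps 2 1 s $ n = (\<Sum>m | theta_exponent 2 1 (3 * m) = n. s ^ nat \<bar>3 * m\<bar>) +
      (\<Sum>m | theta_exponent 2 1 (3 * m + 1) = n. s ^ nat \<bar>3 * m + 1\<bar>) +
      (\<Sum>m | theta_exponent 2 1 (3 * m - 1) = n. s ^ nat \<bar>3 * m - 1\<bar>)"
    using sum_int_mod_3[OF finite_theta_exponent_eq[of 1 2 n], where f = "\<lambda>m. s ^ nat \<bar>m\<bar>"]
    by (simp add: theta_fps_def)
  \<comment> \<open>With \<open>m\<close> replaced by \<open>-m\<close>, the class of -1 mod 3
    consists of the negatives of the numbers \<open>3*m + 1\<close>, which have the same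
    squares.\<close>
  also have "(\<Sum>m | theta_exponent 2 1 (3 * m - 1) = n. s ^ nat \<bar>3 * m - 1\<bar>) =
      (\<Sum>m | theta_exponent 2 1 (3 * - m - 1) = n. s ^ nat \<bar>3 * - m - 1\<bar>)"
    by (rule sum.reindex_bij_witness[of _ uminus uminus]) auto
  also have "(\<Sum>m | theta_exponent 2 1 (3 * - m - 1) = n. s ^ nat \<bar>3 * - m - 1\<bar>) =
      s * (fps_X ^ 1 * (theta_fps 6 5 s oo fps_X ^ 3)) $ n"
    unfolding theta_fps_dilate_nth i sum_distrib_left using s by (intro sum.cong refl) (auto simp: pw)
  also have "(\<Sum>m | theta_exponent 2 1 (3 * m + 1) = n. s ^ nat \<bar>3 * m + 1\<bar>) =
      s * (fps_X ^ 1 * (theta_fps 6 5 s oo fps_X ^ 3)) $ n"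
    unfolding theta_fps_dilate_nth i sum_distrib_left using s by (intro sum.cong refl) (auto simp: pw)
  also have "(\<Sum>m | theta_exponent 2 1 (3 * m) = n. s ^ nat \<bar>3 * m\<bar>) =
      (fps_X ^ 0 * (theta_fps 6 3 s oo fps_X ^ 3)) $ n"
    unfolding theta_fps_dilate_nth i by (intro sum.cong refl) (auto simp: pw)
  also have "(fps_X ^ 0 * (theta_fps 6 3 s oo fps_X ^ 3)) $ n + s * (fps_X ^ 1 * (theta_fps 6 5 s oo fps_X ^ 3)) $ n
      + s * (fps_X ^ 1 * (theta_fps 6 5 s oo fps_X ^ 3)) $ n =
      ((theta_fps 6 3 s oo fps_X ^ 3) + fps_const s * (fps_X * (theta_fps 6 5 s oo fps_X ^ 3)) +
        fps_const s * (fps_X * (theta_fps 6 5 s oo fps_X ^ 3))) $ n"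
    by (simp only: fps_add_nth fps_mult_left_const_nth power_0 power_one_right mult_1)
  also have "(theta_fps 6 3 s oo fps_X ^ 3) + fps_const s * (fps_X * (theta_fps 6 5 s oo fps_X ^ 3)) +
        fps_const s * (fps_X * (theta_fps 6 5 s oo fps_X ^ 3)) =
      (theta_fps 6 3 s oo fps_X ^ 3) + 2 * fps_const s * fps_X * (theta_fps 6 5 s oo fps_X ^ 3)"
    by (simp only: mult.assoc mult_2 distrib_right add.assoc)
  finally show "theta_fps 2 1 s $ n = ((theta_fps 6 3 s oo fps_X ^ 3) + 2 * fps_const s * fps_X * (theta_fps 6 5 s oo fps_X ^ 3)) $ n" .
qed

text \<open>The exponents are the triangular numbers \<open>m*(m + 1)/2\<close>, each attained at
  \<open>m\<close> and at \<open>-1 - m\<close>, so the series is \<open>2 * psi(q)\<close>. This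
  reflection pairs \<open>3*m\<close> with \<open>-3*m - 1\<close> and maps the class of
  \<open>3*m + 1\<close> to itself.\<close>

lemma theta_fps_1_1_dissection:
  "theta_fps 1 1 (1 :: 'a :: field) = 2 * (theta_fps 3 2 1 oo fps_X ^ 3) + fps_X * (theta_fps 3 3 1 oo fps_X ^ 3)"
proof (rule fps_ext)
  fix n
  define h where "h = (\<lambda>m :: int. m * (m - 1) div 2)"
  have half: "2 * h m = m * m - m" for m
    unfolding h_def by (subst dvd_mult_div_cancel) (auto simp: algebra_simps)
  have h: "int (theta_exponent k l m) = int k * h m + int l * m" if "0 < l" "l \<le> k" for k l m
    using int_theta_exponent[OF that] by (simp add: h_def)
  have e: "2 * int (theta_exponent 1 1 m) = m * (m + 1)" "2 * int (theta_exponent 3 2 m) = 3 * m * m + m"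
    "2 * int (theta_exponent 3 3 m) = 3 * m * m + 3 * m" for m
    using half[of m] by (simp_all add: h algebra_simps)
  have i: "theta_exponent 1 1 (3 * m) = 0 + 3 * theta_exponent 3 2 m"
     "theta_exponent 1 1 (3 * m + 1) = 1 + 3 * theta_exponent 3 3 m"
     "theta_exponent 1 1 (3 * - m - 1) = 0 + 3 * theta_exponent 3 2 m" for m
  proof -
    have "2 * int (theta_exponent 1 1 (3 * m)) = 2 * int (0 + 3 * theta_exponent 3 2 m)"
      "2 * int (theta_exponent 1 1 (3 * m + 1)) = 2 * int (1 + 3 * theta_exponent 3 3 m)"
      "2 * int (theta_exponent 1 1 (3 * - m - 1)) = 2 * int (0 + 3 * theta_exponent 3 2 m)"
      using e(2,3)[of m] unfolding e(1) by (simp_all add: algebra_simps)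
    thus "theta_exponent 1 1 (3 * m) = 0 + 3 * theta_exponent 3 2 m"
     "theta_exponent 1 1 (3 * m + 1) = 1 + 3 * theta_exponent 3 3 m"
     "theta_exponent 1 1 (3 * - m - 1) = 0 + 3 * theta_exponent 3 2 m"
      by (simp_all only: mult_left_cancel[OF zero_neq_numeral[symmetric]] of_nat_eq_iff)
  qed
  have "theta_fps 1 1 (1 :: 'a) $ n = (\<Sum>m | theta_exponent 1 1 (3 * m) = n. 1) +
      (\<Sum>m | theta_exponent 1 1 (3 * m + 1) = n. 1) + (\<Sum>m | theta_exponent 1 1 (3 * m - 1) = n. 1)"
    using sum_int_mod_3[OF finite_theta_exponent_eq[of 1 1 n], where f = "\<lambda>_. 1 :: 'a"]
    by (simp add: theta_fps_def)
  also have "(\<Sum>m | theta_exponent 1 1 (3 * m - 1) = n. 1 :: 'a) =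
      (\<Sum>m | theta_exponent 1 1 (3 * - m - 1) = n. 1)"
    by (rule sum.reindex_bij_witness[of _ uminus uminus]) auto
  also have "(\<Sum>m | theta_exponent 1 1 (3 * - m - 1) = n. 1 :: 'a) =
      (fps_X ^ 0 * (theta_fps 3 2 1 oo fps_X ^ 3)) $ n"
    unfolding theta_fps_dilate_nth i by simp
  also have "(\<Sum>m | theta_exponent 1 1 (3 * m + 1) = n. 1 :: 'a) =
      (fps_X ^ 1 * (theta_fps 3 3 1 oo fps_X ^ 3)) $ n"
    unfolding theta_fps_dilate_nth i by simp
  also have "(\<Sum>m | theta_exponent 1 1 (3 * m) = n. 1 :: 'a) =
      (fps_X ^ 0 * (theta_fps 3 2 1 oo fps_X ^ 3)) $ n"
    unfolding theta_fps_dilate_nth i by simp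
  finally show "theta_fps 1 1 (1 :: 'a) $ n = (2 * (theta_fps 3 2 1 oo fps_X ^ 3) + fps_X * (theta_fps 3 3 1 oo fps_X ^ 3)) $ n"
    by (simp only: fps_add_nth power_0 power_one_right mult_1 mult_2 add_ac)
qed

section \<open>Euler products\<close>

definition euler_fps :: "nat \<Rightarrow> 'a :: field fps" where
  "euler_fps k = (fps_X ^ k; fps_X ^ k)\<^sub>\<infinity>"

lemma euler_fps_nth_0: "k > 0 \<Longrightarrow> euler_fps k $ 0 = (1 :: 'a :: field)"
  unfolding euler_fps_def by (rule qpochhammer_inf_nth_0) auto

lemma euler_fps_nonzero: "k > 0 \<Longrightarrow> euler_fps k \<noteq> (0 :: 'a :: field fps)"
  using euler_fps_nth_0[of k, where 'a = 'a] by auto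

lemma fps_X_power_compose:
  fixes h :: "'a :: field fps"
  assumes "h $ 0 = 0"
  shows "fps_X ^ k oo h = h ^ k"
  using fps_compose_power[OF assms, of fps_X k] assms by simp

lemma euler_fps_compose:
  fixes h :: "'a :: field fps"
  assumes "h $ 0 = 0" "k > 0"
  shows "euler_fps k oo h = (h ^ k; h ^ k)\<^sub>\<infinity>"
  using assms by (simp add: euler_fps_def qpochhammer_inf_compose fps_X_power_compose)

lemma euler_fps_compose_X_power:
  assumes "k > 0" "j > 0"
  shows "euler_fps k oo fps_X ^ j = (euler_fps (j * k) :: 'a :: field fps)"
  using assms by (simp add: euler_fps_compose flip: power_mult) (simp add: euler_fps_def)

lemma qpochhammer_inf_X_multisection:
  assumes "a > 0" "k > 0" "d > 0"
  shows "(fps_X ^ a; fps_X ^ k)\<^sub>\<infinity> = (\<Prod>r<d. (fps_X ^ (a + k * r); fps_X ^ (k * d))\<^sub>\<infinity> :: 'a :: field fps)"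
  using qpochhammer_inf_multisection[of "fps_X ^ a" "fps_X ^ k :: 'a fps" d] assms
  by (simp add: power_add flip: power_mult)

lemma euler_fps_odd:
  "k > 0 \<Longrightarrow> (fps_X ^ k; fps_X ^ (2 * k))\<^sub>\<infinity> * euler_fps (2 * k) = (euler_fps k :: 'a :: field fps)"
  using qpochhammer_inf_X_multisection[of k k 2, where 'a = 'a]
  by (simp add: euler_fps_def lessThan_Suc numeral_2_eq_2 mult_ac)

lemma qpochhammer_inf_X_minus:
  assumes "k > 0"
  shows "(- (fps_X ^ k); fps_X ^ k)\<^sub>\<infinity> * euler_fps k = (euler_fps (2 * k) :: 'a :: field fps)"
proof -
  have "(fps_X ^ k; fps_X ^ k)\<^sub>\<infinity> * (- (fps_X ^ k); fps_X ^ k)\<^sub>\<infinity> = ((fps_X ^ k)\<^sup>2; (fps_X ^ k)\<^sup>2 :: 'a fps)\<^sub>\<infinity>"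
    using assms by (intro qpochhammer_inf_minus) auto
  thus ?thesis by (simp add: euler_fps_def mult.commute flip: power_mult)
qed

text \<open>Exponents are sorted by residue mod 6. These relations turn the products at odd residues
  in the theorem, and those in \<open>theta_fps 6 5\<close>, into Euler products.\<close>

lemma euler_fps_sections_6:
  defines "u \<equiv> \<lambda>a. (fps_X ^ a; fps_X ^ 6)\<^sub>\<infinity> :: 'a :: field fps"
  shows "euler_fps 1 = u 1 * u 2 * u 3 * u 4 * u 5 * euler_fps 6"
    and "euler_fps 2 = u 2 * u 4 * euler_fps 6"
    and "euler_fps 3 = u 3 * (euler_fps 6 :: 'a fps)"
proof -
  show "euler_fps 1 = u 1 * u 2 * u 3 * u 4 * u 5 * euler_fps 6"
    using qpochhammer_inf_X_multisection[of 1 1 6, where 'a = 'a]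
    by (simp add: euler_fps_def u_def eval_nat_numeral lessThan_Suc mult_ac)
  show "euler_fps 2 = u 2 * u 4 * euler_fps 6"
    using qpochhammer_inf_X_multisection[of 2 2 3, where 'a = 'a]
    by (simp add: euler_fps_def u_def eval_nat_numeral lessThan_Suc mult_ac)
  show "euler_fps 3 = u 3 * euler_fps 6"
    using qpochhammer_inf_X_multisection[of 3 3 2, where 'a = 'a]
    by (simp add: euler_fps_def u_def eval_nat_numeral lessThan_Suc mult_ac)
qed

section \<open>Theta series as quotients of Euler products\<close>

lemma theta_fps_2_1_minus: "theta_fps 2 1 (-1) * euler_fps 2 = (euler_fps 1 :: 'a :: field fps)\<^sup>2"
proof -
  define u :: "'a fps" where "u = (fps_X; fps_X\<^sup>2)\<^sub>\<infinity>"
  have "theta_fps 2 1 (-1) = u * u * euler_fps 2"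
    using triple_product[of "-1 :: 'a" 1 2] by (simp add: u_def euler_fps_def fps_const_neg[symmetric] del: fps_const_neg)
  moreover have "euler_fps 1 = u * euler_fps 2"
    using euler_fps_odd[of 1, where 'a = 'a] by (simp add: u_def)
  ultimately show ?thesis by (simp add: power2_eq_square mult_ac)
qed

lemma theta_fps_6_3_minus: "theta_fps 6 3 (-1) * euler_fps 6 = (euler_fps 3 :: 'a :: field fps)\<^sup>2"
proof -
  define u :: "'a fps" where "u = (fps_X ^ 3; fps_X ^ 6)\<^sub>\<infinity>"
  have "theta_fps 6 3 (-1) = u * u * euler_fps 6"
    using triple_product[of "-1 :: 'a" 3 6] by (simp add: u_def euler_fps_def fps_const_neg[symmetric] del: fps_const_neg)
  moreover have "euler_fps 3 = u * euler_fps 6"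
    using euler_fps_odd[of 3, where 'a = 'a] by (simp add: u_def)
  ultimately show ?thesis by (simp add: power2_eq_square mult_ac)
qed

lemma theta_fps_6_5_minus:
  "theta_fps 6 5 (-1) * euler_fps 2 * euler_fps 3 = euler_fps 1 * (euler_fps 6 :: 'a :: field fps)\<^sup>2"
proof -
  have "theta_fps 6 5 (-1) = (fps_X ^ 1; fps_X ^ 6)\<^sub>\<infinity> * (fps_X ^ 5; fps_X ^ 6)\<^sub>\<infinity> * (euler_fps 6 :: 'a fps)"
    using triple_product[of "-1 :: 'a" 5 6] by (simp add: euler_fps_def fps_const_neg[symmetric] del: fps_const_neg)
  thus ?thesis
    unfolding euler_fps_sections_6 by (simp only: power2_eq_square mult_ac)
qed

text \<open>In \<open>(-q; q) = f_2 / f_1\<close> the exponents not divisible by 3 are exactly those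
  of the triple product; dividing by the section \<open>(-q^3; q^3) = f_6 / f_3\<close> isolates
  them.\<close>

lemma theta_fps_3_2:
  "theta_fps 3 2 1 * euler_fps 1 * euler_fps 6 = euler_fps 2 * (euler_fps 3 :: 'a :: field fps)\<^sup>2"
proof -
  let ?X = "fps_X :: 'a fps"
  have th: "theta_fps 3 2 1 = (- ?X; ?X ^ 3)\<^sub>\<infinity> * (- (?X\<^sup>2); ?X ^ 3)\<^sub>\<infinity> * euler_fps 3"
    using triple_product[of "1 :: 'a" 2 3] by (simp add: euler_fps_def)
  have "(- ?X; ?X)\<^sub>\<infinity> = (- ?X; ?X ^ 3)\<^sub>\<infinity> * (- (?X\<^sup>2); ?X ^ 3)\<^sub>\<infinity> * (- (?X ^ 3); ?X ^ 3)\<^sub>\<infinity>"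
    using qpochhammer_inf_multisection[of "- ?X" ?X 3]
    by (simp add: eval_nat_numeral lessThan_Suc mult_ac)
  moreover have "(- ?X; ?X)\<^sub>\<infinity> * euler_fps 1 = euler_fps 2" "(- (?X ^ 3); ?X ^ 3)\<^sub>\<infinity> * euler_fps 3 = euler_fps 6"
    using qpochhammer_inf_X_minus[of 1, where 'a = 'a] qpochhammer_inf_X_minus[of 3, where 'a = 'a] by simp_all
  ultimately show ?thesis
    unfolding th by (simp add: power2_eq_square mult_ac flip: \<open>_ = euler_fps 2\<close> \<open>_ = euler_fps 6\<close>)
qed

section \<open>Euler products under \<open>q -> -q\<close> and under cube roots of unity\<close>

lemma euler_fps_compose_uminus_X:
  fixes E :: "nat \<Rightarrow> 'a :: field fps"
  defines "E \<equiv> euler_fps"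
  shows "E 1 * (E 1 oo - fps_X) * E 4 = E 2 ^ 3"
proof -
  let ?X = "fps_X :: 'a fps"
  have "E 1 oo - ?X = (- ?X; - ?X)\<^sub>\<infinity>"
    unfolding E_def by (subst euler_fps_compose) auto
  \<comment> \<open>Only odd exponents change sign, and the odd factors at \<open>q\<close> and
    \<open>-q\<close> pair up to \<open>(q^2; q^4) = f_2 / f_4\<close>.\<close>
  also have "\<dots> = (- ?X; ?X\<^sup>2)\<^sub>\<infinity> * E 2"
    using qpochhammer_inf_multisection[of "- ?X" "- ?X" 2]
    by (simp add: eval_nat_numeral lessThan_Suc E_def euler_fps_def mult_ac)
  finally have 1: "E 1 oo - ?X = (- ?X; ?X\<^sup>2)\<^sub>\<infinity> * E 2" .
  have 2: "E 1 = (?X; ?X\<^sup>2)\<^sub>\<infinity> * E 2"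
    using euler_fps_odd[of 1, where 'a = 'a] by (simp add: E_def)
  have "(?X; ?X\<^sup>2)\<^sub>\<infinity> * (- ?X; ?X\<^sup>2)\<^sub>\<infinity> = (?X\<^sup>2; (?X\<^sup>2)\<^sup>2)\<^sub>\<infinity>"
    by (rule qpochhammer_inf_minus) auto
  hence 3: "(?X; ?X\<^sup>2)\<^sub>\<infinity> * (- ?X; ?X\<^sup>2)\<^sub>\<infinity> = (?X\<^sup>2; ?X ^ 4)\<^sub>\<infinity>"
    by (simp flip: power_mult)
  have 4: "(?X\<^sup>2; ?X ^ 4)\<^sub>\<infinity> * E 4 = E 2"
    using euler_fps_odd[of 2, where 'a = 'a] by (simp add: E_def)
  have "E 1 * (E 1 oo - ?X) * E 4 =
      ((?X; ?X\<^sup>2)\<^sub>\<infinity> * (- ?X; ?X\<^sup>2)\<^sub>\<infinity>) * E 4 * E 2 * E 2"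
    unfolding 1 by (subst 2) (simp only: mult_ac)
  thus ?thesis unfolding 3 4 by (simp add: power3_eq_cube)
qed

lemma euler_fps_even_compose_uminus_X:
  fixes k :: nat
  assumes "even k" "k > 0"
  shows "euler_fps k oo - fps_X = (euler_fps k :: 'a :: field fps)"
  using assms by (subst euler_fps_compose) (auto simp: euler_fps_def)

text \<open>Factors with exponent divisible by 3 are invariant under \<open>q -> w q\<close> and
  contribute \<open>f_3^3\<close>; for any other exponent \<open>i\<close> the three conjugate
  factors multiply to \<open>1 - q^(3*i)\<close>, which gives \<open>f_3 / f_9\<close> in
  total.\<close>

lemma euler_fps_conjugates:
  fixes w :: "'a :: field" and E :: "nat \<Rightarrow> 'a fps"
  assumes w: "1 + w + w\<^sup>2 = 0"
  defines "E \<equiv> euler_fps"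
  shows "E 1 * (E 1 oo (fps_const w * fps_X)) * (E 1 oo (fps_const (w\<^sup>2) * fps_X)) * E 9 = E 3 ^ 4"
proof -
  let ?X = "fps_X :: 'a fps"
  have w3: "w ^ 3 = 1" using w by algebra
  have w4: "w ^ 4 = w" using w by algebra
  have sec: "E 1 oo (fps_const c * ?X) = (fps_const c * ?X; ?X ^ 3)\<^sub>\<infinity> * (fps_const (c\<^sup>2) * ?X\<^sup>2; ?X ^ 3)\<^sub>\<infinity> * E 3"
    if "c ^ 3 = 1" for c
  proof -
    have "E 1 oo (fps_const c * ?X) = (fps_const c * ?X; fps_const c * ?X)\<^sub>\<infinity>"
      unfolding E_def by (subst euler_fps_compose) auto
    also have "\<dots> = (\<Prod>r<3. ((fps_const c * ?X) * (fps_const c * ?X) ^ r; (fps_const c * ?X) ^ 3)\<^sub>\<infinity>)"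
      by (rule qpochhammer_inf_multisection) auto
    also have "(fps_const c * ?X) ^ 3 = ?X ^ 3"
      using that by (simp add: power_mult_distrib fps_const_power)
    also have "(\<Prod>r<3. ((fps_const c * ?X) * (fps_const c * ?X) ^ r; ?X ^ 3)\<^sub>\<infinity>) =
        ((fps_const c * ?X) ^ 1; ?X ^ 3)\<^sub>\<infinity> * ((fps_const c * ?X) ^ 2; ?X ^ 3)\<^sub>\<infinity> * ((fps_const c * ?X) ^ 3; ?X ^ 3)\<^sub>\<infinity>"
      by (simp add: eval_nat_numeral lessThan_Suc mult_ac)
    also have "(fps_const c * ?X) ^ 3 = ?X ^ 3"
      using that by (simp add: power_mult_distrib fps_const_power)
    also have "(fps_const c * ?X) ^ 2 = fps_const (c\<^sup>2) * ?X\<^sup>2"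
      by (simp add: power_mult_distrib fps_const_power)
    finally show ?thesis by (simp add: E_def euler_fps_def)
  qed
  have s0: "E 1 = (?X; ?X ^ 3)\<^sub>\<infinity> * (?X\<^sup>2; ?X ^ 3)\<^sub>\<infinity> * E 3"
    using sec[of 1] by simp
  have s1: "E 1 oo (fps_const w * ?X) = (fps_const w * ?X; ?X ^ 3)\<^sub>\<infinity> * (fps_const (w\<^sup>2) * ?X\<^sup>2; ?X ^ 3)\<^sub>\<infinity> * E 3"
    using sec[OF w3] .
  have w23: "(w\<^sup>2) ^ 3 = 1" "(w\<^sup>2)\<^sup>2 = w"
  proof -
    have "(w\<^sup>2) ^ 3 = (w ^ 3)\<^sup>2" "(w\<^sup>2)\<^sup>2 = w ^ 4" by algebra+
    thus "(w\<^sup>2) ^ 3 = 1" "(w\<^sup>2)\<^sup>2 = w" by (simp_all only: w3 w4 power_one)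
  qed
  have s2: "E 1 oo (fps_const (w\<^sup>2) * ?X) = (fps_const (w\<^sup>2) * ?X; ?X ^ 3)\<^sub>\<infinity> * (fps_const w * ?X\<^sup>2; ?X ^ 3)\<^sub>\<infinity> * E 3"
    using sec[OF w23(1)] by (simp only: w23(2))
  have c1: "(?X; ?X ^ 3)\<^sub>\<infinity> * (fps_const w * ?X; ?X ^ 3)\<^sub>\<infinity> * (fps_const (w\<^sup>2) * ?X; ?X ^ 3)\<^sub>\<infinity> = (?X ^ 3; ?X ^ 9)\<^sub>\<infinity>"
    using qpochhammer_inf_cube[OF _ _ w, of ?X "?X ^ 3"] by (simp flip: power_mult)
  have c2: "(?X\<^sup>2; ?X ^ 3)\<^sub>\<infinity> * (fps_const w * ?X\<^sup>2; ?X ^ 3)\<^sub>\<infinity> * (fps_const (w\<^sup>2) * ?X\<^sup>2; ?X ^ 3)\<^sub>\<infinity> = (?X ^ 6; ?X ^ 9)\<^sub>\<infinity>"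
    using qpochhammer_inf_cube[OF _ _ w, of "?X\<^sup>2" "?X ^ 3"] by (simp flip: power_mult)
  have e3: "E 3 = (?X ^ 3; ?X ^ 9)\<^sub>\<infinity> * (?X ^ 6; ?X ^ 9)\<^sub>\<infinity> * E 9"
    using qpochhammer_inf_X_multisection[of 3 3 3, where 'a = 'a]
    by (simp add: E_def euler_fps_def eval_nat_numeral lessThan_Suc mult_ac)
  have "E 1 * (E 1 oo (fps_const w * ?X)) * (E 1 oo (fps_const (w\<^sup>2) * ?X)) * E 9 =
      ((?X; ?X ^ 3)\<^sub>\<infinity> * (fps_const w * ?X; ?X ^ 3)\<^sub>\<infinity> * (fps_const (w\<^sup>2) * ?X; ?X ^ 3)\<^sub>\<infinity>) *
      ((?X\<^sup>2; ?X ^ 3)\<^sub>\<infinity> * (fps_const w * ?X\<^sup>2; ?X ^ 3)\<^sub>\<infinity> * (fps_const (w\<^sup>2) * ?X\<^sup>2; ?X ^ 3)\<^sub>\<infinity>) * E 9 * E 3 ^ 3"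
    unfolding s1 s2 by (subst s0) (simp only: mult_ac power3_eq_cube)
  also have "\<dots> = E 3 * E 3 ^ 3"
    unfolding c1 c2 e3[symmetric] ..
  finally show ?thesis by (simp flip: power_Suc)
qed

section \<open>Cubic identities and trisection\<close>

lemma fps_compose_X_power_inject:
  fixes f g :: "'a :: field fps"
  assumes "f oo fps_X ^ k = g oo fps_X ^ k" "k > 0"
  shows "f = g"
proof (rule fps_ext)
  fix n
  have "(f oo fps_X ^ k) $ (k * n) = (g oo fps_X ^ k) $ (k * n)" using assms by simp
  thus "f $ n = g $ n" using assms(2) by (simp add: fps_compose_X_power_nth)
qed

lemma fps_compose_X_power_root_of_unity:
  fixes f :: "'a :: field fps"
  assumes "c ^ k = 1" "k > 0"
  shows "(f oo fps_X ^ k) oo (fps_const c * fps_X) = f oo fps_X ^ k"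
proof -
  have "(f oo fps_X ^ k) oo (fps_const c * fps_X) = f oo (fps_X ^ k oo (fps_const c * fps_X))"
    using assms by (intro fps_compose_assoc[symmetric]) auto
  also have "fps_X ^ k oo (fps_const c * fps_X) = fps_X ^ k"
    using assms by (simp add: fps_X_power_compose power_mult_distrib fps_const_power)
  finally show ?thesis .
qed

text \<open>The components are series in \<open>q^3\<close> and so are fixed under
  \<open>q -> w q\<close>; only the single factor \<open>q\<close> acquires powers of
  \<open>w\<close>, and \<open>(G + Y) * (G + w*Y) * (G + w^2*Y) = G^3 + Y^3\<close>.\<close>

lemma two_term_3_dissection_norm:
  fixes f g h :: "'a :: field fps" and w :: 'a
  assumes f: "f = (g oo fps_X ^ 3) + fps_X * (h oo fps_X ^ 3)" and w: "1 + w + w\<^sup>2 = 0"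
  shows "f * (f oo (fps_const w * fps_X)) * (f oo (fps_const (w\<^sup>2) * fps_X)) =
    (g ^ 3 + fps_X * h ^ 3) oo fps_X ^ 3"
proof -
  let ?X = "fps_X :: 'a fps"
  define W G H where "W = fps_const w" and "G = g oo ?X ^ 3" and "H = h oo ?X ^ 3"
  have w3: "w ^ 3 = 1" using w by algebra
  have w23: "(w\<^sup>2) ^ 3 = 1"
  proof -
    have "(w\<^sup>2) ^ 3 = (w ^ 3)\<^sup>2" by algebra
    thus ?thesis by (simp only: w3 power_one)
  qed
  have comp: "f oo (fps_const c * ?X) = G + fps_const c * ?X * H" if "c ^ 3 = 1" for c
    unfolding f using that
    by (simp add: fps_compose_add_distrib fps_compose_mult_distrib fps_compose_X_power_root_of_unity G_def H_def)
  have W: "1 + W + W\<^sup>2 = 0"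
    using w by (metis W_def fps_const_add fps_const_power fps_const_1_eq_1 fps_const_0_eq_0)
  have "f * (f oo (fps_const w * ?X)) * (f oo (fps_const (w\<^sup>2) * ?X)) =
      (G + ?X * H) * (G + W * (?X * H)) * (G + W\<^sup>2 * (?X * H))"
    unfolding comp[OF w3] comp[OF w23] using f
    by (simp add: W_def G_def H_def mult.assoc fps_const_power)
  also have "\<dots> = G ^ 3 + (?X * H) ^ 3"
  proof -
    have "(G + Y) * (G + W * Y) * (G + W\<^sup>2 * Y) = G ^ 3 + Y ^ 3" for Y
      using W by algebra
    thus ?thesis .
  qed
  also have "\<dots> = (g ^ 3 + ?X * h ^ 3) oo ?X ^ 3"
    by (simp add: G_def H_def power_mult_distrib fps_compose_add_distrib fps_compose_mult_distrib fps_compose_power)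
  finally show ?thesis .
qed

text \<open>This is the norm of \<open>f_1\<close> after \<open>q -> q^2\<close>: squaring exchanges
  \<open>w\<close> and \<open>w^2\<close>, so the set of conjugates is preserved.\<close>

lemma euler_fps_2_conjugates:
  fixes w :: "'a :: field" and E :: "nat \<Rightarrow> 'a fps"
  assumes w: "1 + w + w\<^sup>2 = 0"
  defines "E \<equiv> euler_fps"
  shows "E 2 * (E 2 oo (fps_const w * fps_X)) * (E 2 oo (fps_const (w\<^sup>2) * fps_X)) * E 18 = E 6 ^ 4"
proof -
  let ?X = "fps_X :: 'a fps"
  have w4: "w ^ 4 = w" using w by algebra
  have sq: "(E 1 oo (fps_const c * ?X)) oo ?X\<^sup>2 = E 1 oo (fps_const c * ?X\<^sup>2)" for c
    by (subst fps_compose_assoc[symmetric]) (auto simp: fps_compose_mult_distrib)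
  have dil: "E 2 oo (fps_const c * ?X) = E 1 oo (fps_const (c\<^sup>2) * ?X\<^sup>2)" for c
    unfolding E_def by (simp add: euler_fps_compose power_mult_distrib fps_const_power)
  have "(E 1 * (E 1 oo (fps_const w * ?X)) * (E 1 oo (fps_const (w\<^sup>2) * ?X)) * E 9) oo ?X\<^sup>2 = E 3 ^ 4 oo ?X\<^sup>2"
    unfolding E_def euler_fps_conjugates[OF w] ..
  hence "E 2 * (E 1 oo (fps_const w * ?X\<^sup>2)) * (E 1 oo (fps_const (w\<^sup>2) * ?X\<^sup>2)) * E 18 = E 6 ^ 4"
    by (simp add: fps_compose_mult_distrib fps_compose_power[symmetric] sq[simplified])
       (simp add: E_def euler_fps_compose_X_power)
  moreover have "(w\<^sup>2)\<^sup>2 = w" using w4 by (simp flip: power_mult)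
  ultimately show ?thesis unfolding dil by (simp only: mult_ac)
qed

text \<open>Ramanujan's \<open>psi(q) = f_2^2 / f_1\<close>, in the product form that the triple
  product delivers for half of \<open>theta_fps 1 1 1\<close>.\<close>

definition psi_fps :: "'a :: field fps" where
  "psi_fps = (- fps_X; fps_X)\<^sub>\<infinity>\<^sup>2 * euler_fps 1"

lemma theta_fps_diagonal_eq_psi:
  assumes "k > 0"
  shows "theta_fps k k 1 = 2 * (psi_fps oo fps_X ^ k :: 'a :: field fps)"
proof -
  have "((- fps_X; fps_X)\<^sub>\<infinity> oo fps_X ^ k :: 'a fps) = (- (fps_X ^ k); fps_X ^ k)\<^sub>\<infinity>"
    using assms by (subst qpochhammer_inf_compose) (auto simp: fps_compose_uminus)
  thus ?thesis
    using assms triple_product_diagonal[of k, where 'a = 'a] euler_fps_compose_X_power[of 1 k, where 'a = 'a]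
    by (simp add: psi_fps_def euler_fps_def fps_compose_mult_distrib fps_compose_power[symmetric] mult.assoc)
qed

lemma psi_fps_mult_euler: "psi_fps * euler_fps 1 = (euler_fps 2 :: 'a :: field fps)\<^sup>2"
  using qpochhammer_inf_X_minus[of 1, where 'a = 'a, symmetric]
  by (simp add: psi_fps_def power2_eq_square mult_ac)

text \<open>Half of the dissection of \<open>theta_fps 1 1 1\<close>, where characteristic 0 permits
  cancelling 2; the last component is psi again, at \<open>q^9\<close>.\<close>

lemma psi_fps_dissection:
  "psi_fps = (theta_fps 3 2 1 oo fps_X ^ 3) + fps_X * (psi_fps oo fps_X ^ 3 oo fps_X ^ 3 :: 'a :: field_char_0 fps)"
proof -
  have "2 * psi_fps = theta_fps 1 1 (1 :: 'a)"
    by (simp add: theta_fps_diagonal_eq_psi)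
  also have "\<dots> = 2 * ((theta_fps 3 2 1 oo fps_X ^ 3) + fps_X * (psi_fps oo fps_X ^ 3 oo fps_X ^ 3))"
    unfolding theta_fps_1_1_dissection theta_fps_diagonal_eq_psi[OF zero_less_numeral]
    by (simp add: fps_compose_mult_distrib distrib_left mult_ac)
  finally show ?thesis
    by (rule mult_left_cancel[THEN iffD1, rotated]) simp
qed

lemma ex_complex_cube_root_of_unity: "\<exists>w :: complex. 1 + w + w\<^sup>2 = 0"
  by (rule exI[of _ "Complex (- 1 / 2) (sqrt 3 / 2)"]) (simp add: complex_eq_iff power2_eq_square)

text \<open>The norm of psi is computed twice: from its two-term dissection, and from
  \<open>psi * f_1 = f_2^2\<close> with the norms of \<open>f_1\<close> and \<open>f_2\<close>. Both
  results are series in \<open>q^3\<close>, which is then replaced by \<open>q\<close>. The complex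
  numbers supply the cube root of unity.\<close>

lemma cubic_identity_psi:
  fixes E :: "nat \<Rightarrow> complex fps"
  defines "E \<equiv> euler_fps"
  shows "(theta_fps 3 2 1 ^ 3 + fps_X * (psi_fps oo fps_X ^ 3) ^ 3) * (E 1 ^ 4 * E 6 ^ 2) = E 2 ^ 8 * E 3"
proof (rule fps_compose_X_power_inject)
  let ?X = "fps_X :: complex fps" and ?psi = "psi_fps :: complex fps"
  obtain w :: complex where w: "1 + w + w\<^sup>2 = 0"
    using ex_complex_cube_root_of_unity by blast
  let ?s = "\<lambda>c f. f oo (fps_const c * ?X)"
  let ?N = "\<lambda>f. f * ?s w f * ?s (w\<^sup>2) f"
  have N: "?N (f * g) = ?N f * ?N g" for f g
    by (simp add: fps_compose_mult_distrib mult_ac)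
  \<comment> \<open>\<open>E 9\<close> and \<open>E 18\<close> will stand for \<open>e\<close> and
    \<open>f\<close>: they are the denominators of the norms of \<open>E 1\<close> and
    \<open>E 2\<close>.\<close>
  have alg: "a * (b * e) * f\<^sup>2 = (c * f)\<^sup>2 * e" if "a * b = c * c" for a b c e f :: "complex fps"
    using that by algebra
  have "?psi * E 1 = E 2 * E 2"
    using psi_fps_mult_euler by (simp add: E_def power2_eq_square)
  hence "?N ?psi * ?N (E 1) = ?N (E 2) * ?N (E 2)"
    by (simp only: N[symmetric])
  hence "?N ?psi * (?N (E 1) * E 9) * E 18 ^ 2 = (?N (E 2) * E 18)\<^sup>2 * E 9"
    by (rule alg)
  hence "?N ?psi * (E 3 ^ 4 * E 18 ^ 2) = E 6 ^ 8 * E 9"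
    unfolding E_def euler_fps_conjugates[OF w] euler_fps_2_conjugates[OF w]
    by (simp add: mult.assoc flip: power_mult)
  moreover have "?N ?psi = (theta_fps 3 2 1 ^ 3 + ?X * (?psi oo ?X ^ 3) ^ 3) oo ?X ^ 3"
    by (rule two_term_3_dissection_norm[OF psi_fps_dissection w])
  ultimately show "((theta_fps 3 2 1 ^ 3 + ?X * (?psi oo ?X ^ 3) ^ 3) * (E 1 ^ 4 * E 6 ^ 2)) oo ?X ^ 3 =
      (E 2 ^ 8 * E 3) oo ?X ^ 3"
    by (simp add: E_def euler_fps_compose_X_power fps_compose_mult_distrib[of "?X ^ 3"]
          fps_compose_power[of "?X ^ 3", symmetric])
qed simp

text \<open>The same computation for \<open>phi(-q) = f_1^2 / f_2\<close>. The second component of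
  its dissection is \<open>-2 * Q\<close>, whose cube is the source of the coefficient -8.\<close>

lemma cubic_identity_phi:
  fixes E :: "nat \<Rightarrow> complex fps"
  defines "E \<equiv> euler_fps"
  shows "(theta_fps 6 3 (-1) ^ 3 - 8 * fps_X * theta_fps 6 5 (-1) ^ 3) * (E 2 ^ 4 * E 3 ^ 2) = E 1 ^ 8 * E 6"
proof (rule fps_compose_X_power_inject)
  let ?X = "fps_X :: complex fps"
  define phi Q R :: "complex fps" where "phi = theta_fps 2 1 (-1)" and "Q = theta_fps 6 5 (-1)"
    and "R = theta_fps 6 3 (-1) ^ 3 - 8 * ?X * Q ^ 3"
  obtain w :: complex where w: "1 + w + w\<^sup>2 = 0"
    using ex_complex_cube_root_of_unity by blast
  let ?s = "\<lambda>c f. f oo (fps_const c * ?X)"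
  let ?N = "\<lambda>f. f * ?s w f * ?s (w\<^sup>2) f"
  have N: "?N (f * g) = ?N f * ?N g" for f g
    by (simp add: fps_compose_mult_distrib mult_ac)
  have alg: "a * (b * e) * f\<^sup>2 = (c * f)\<^sup>2 * e" if "a * b = c * c" for a b c e f :: "complex fps"
    using that by algebra
  have "phi * E 2 = E 1 * E 1"
    using theta_fps_2_1_minus by (simp add: E_def phi_def power2_eq_square)
  hence "?N phi * ?N (E 2) = ?N (E 1) * ?N (E 1)"
    by (simp only: N[symmetric])
  hence "?N phi * (?N (E 2) * E 18) * E 9 ^ 2 = (?N (E 1) * E 9)\<^sup>2 * E 18"
    by (rule alg)
  hence "?N phi * (E 6 ^ 4 * E 9 ^ 2) = E 3 ^ 8 * E 18"
    unfolding E_def euler_fps_conjugates[OF w] euler_fps_2_conjugates[OF w]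
    by (simp add: mult.assoc flip: power_mult)
  moreover have "phi = (theta_fps 6 3 (-1) oo ?X ^ 3) + ?X * ((- 2 * Q) oo ?X ^ 3)"
    unfolding phi_def by (subst theta_fps_2_1_dissection)
      (simp_all add: Q_def fps_compose_mult_distrib fps_compose_uminus mult_ac
         flip: fps_const_neg)
  hence "?N phi = (theta_fps 6 3 (-1) ^ 3 + ?X * (- 2 * Q) ^ 3) oo ?X ^ 3"
    by (rule two_term_3_dissection_norm[OF _ w])
  hence "?N phi = R oo ?X ^ 3"
    by (simp add: R_def power_mult_distrib mult_ac)
  ultimately have "(R * (E 2 ^ 4 * E 3 ^ 2)) oo ?X ^ 3 = (E 1 ^ 8 * E 6) oo ?X ^ 3"
    by (simp add: E_def euler_fps_compose_X_power fps_compose_mult_distrib[of "?X ^ 3"]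
          fps_compose_power[of "?X ^ 3", symmetric])
  thus "((theta_fps 6 3 (-1) ^ 3 - 8 * ?X * theta_fps 6 5 (-1) ^ 3) * (E 2 ^ 4 * E 3 ^ 2)) oo ?X ^ 3 =
      (E 1 ^ 8 * E 6) oo ?X ^ 3"
    by (simp only: R_def Q_def)
qed simp

section \<open>Extraction of the exponents divisible by 3\<close>

lemma trisect_mult_compose:
  fixes f g :: "'a :: comm_ring_1 fps"
  shows "((g oo fps_X ^ 3) * f) $ (3 * n) = (g * Abs_fps (\<lambda>n. f $ (3 * n))) $ n"
proof -
  have "((g oo fps_X ^ 3) * f) $ (3 * n) = (\<Sum>i=0..3*n. (g oo fps_X ^ 3) $ i * f $ (3 * n - i))"
    by (rule fps_mult_nth)
  also have "\<dots> = (\<Sum>i\<in>(*) 3 ` {0..n}. (g oo fps_X ^ 3) $ i * f $ (3 * n - i))"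
  proof (rule sum.mono_neutral_right)
    show "\<forall>i\<in>{0..3 * n} - (*) 3 ` {0..n}. (g oo fps_X ^ 3) $ i * f $ (3 * n - i) = 0"
      by (auto simp: fps_compose_X_power_nth elim!: dvdE)
  qed auto
  also have "\<dots> = (\<Sum>i=0..n. g $ i * f $ (3 * (n - i)))"
    by (subst sum.reindex) (auto simp: inj_on_def fps_compose_X_power_nth right_diff_distrib')
  finally show ?thesis by (simp add: fps_mult_nth)
qed

lemma trisect_dissection:
  fixes f a b c :: "'a :: comm_ring_1 fps"
  assumes "f = (a oo fps_X ^ 3) + fps_X * (b oo fps_X ^ 3) + fps_X\<^sup>2 * (c oo fps_X ^ 3)"
  shows "f $ (3 * n) = a $ n"
proof -
  have "\<not> 3 dvd 3 * n - 1" if "n > 0" using that by presburger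
  moreover have "\<not> 3 dvd 3 * n - 2" if "n > 0" using that by presburger
  ultimately show ?thesis
    unfolding assms by (auto simp: fps_compose_X_power_nth fps_X_power_mult_nth)
qed

text \<open>Starting from \<open>D * psi * phi * f_3 = f_6\<close>, with \<open>phi\<close> at
  \<open>-q\<close>, multiplication by the cofactors of \<open>psi\<close> and \<open>phi\<close> in
  their norms leaves \<open>D\<close> times a series in \<open>q^3\<close>, and such a series passes
  through the trisection.\<close>

lemma trisected_PD_equation:
  fixes E :: "nat \<Rightarrow> complex fps" and q :: "complex fps"
  defines "E \<equiv> euler_fps" and "q \<equiv> fps_X"
  defines "P \<equiv> theta_fps 3 2 1" and "S \<equiv> psi_fps oo fps_X ^ 3"
    and "R \<equiv> theta_fps 6 3 (-1)" and "Q \<equiv> theta_fps 6 5 (-1)"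
  shows "Abs_fps (\<lambda>n. of_nat (PD (3 * n))) * (P ^ 3 + q * S ^ 3) * (R ^ 3 - 8 * q * Q ^ 3) * E 1 =
    E 2 * (P\<^sup>2 * R\<^sup>2 + q * (2 * S\<^sup>2 * R * Q - 4 * P * S * Q\<^sup>2))"
proof -
  define V :: "complex fps \<Rightarrow> complex fps" where "V = (\<lambda>f. f oo q ^ 3)"
  have V: "V (f + g) = V f + V g" "V (f - g) = V f - V g" "V (f * g) = V f * V g" "V (f ^ n) = V f ^ n"
    "V (numeral k) = numeral k" "V q = q ^ 3" for f g n k
    by (simp_all add: V_def q_def fps_compose_add_distrib fps_compose_sub_distrib fps_compose_mult_distrib
        fps_compose_power)
  define phi psi D where "phi = (theta_fps 2 1 (-1) :: complex fps)" and "psi = (psi_fps :: complex fps)"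
    and "D = (Abs_fps (\<lambda>n. of_nat (PD n)) :: complex fps)"
  have psi: "psi = V P + q * V S"
    using psi_fps_dissection[where 'a = complex] by (simp add: psi_def V_def P_def S_def q_def)
  have phi: "phi = V R - 2 * q * V Q"
    using theta_fps_2_1_dissection[of "-1 :: complex"]
    by (simp add: phi_def V_def R_def Q_def q_def flip: fps_const_neg)
  have "psi * phi = E 1 * E 2"
  proof -
    have "psi * E 1 = (E 2)\<^sup>2" "phi * E 2 = (E 1)\<^sup>2"
      using psi_fps_mult_euler theta_fps_2_1_minus by (simp_all add: psi_def phi_def E_def)
    hence "(psi * phi) * (E 1 * E 2) = (E 1 * E 2) * (E 1 * E 2)" by algebra
    moreover have "E 1 * E 2 \<noteq> 0" by (simp add: E_def euler_fps_nonzero)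
    ultimately show ?thesis by (rule mult_right_cancel[THEN iffD1, rotated])
  qed
  moreover have "D * E 1 * E 2 * E 3 = E 6"
    using PD_fps[where 'a = complex] by (simp add: D_def E_def euler_fps_def)
  moreover have "E 3 = V (E 1)" "E 6 = V (E 2)"
    by (simp_all add: E_def V_def q_def euler_fps_compose_X_power)
  ultimately have D: "D * (psi * phi) * V (E 1) = V (E 2)" by (simp add: mult.assoc)
  define G where "G = (P ^ 3 + q * S ^ 3) * (R ^ 3 - 8 * q * Q ^ 3) * E 1"
  \<comment> \<open>The product of the two cofactors is expanded and sorted by powers of
    \<open>q\<close> mod 3: \<open>a\<close> collects \<open>q^0\<close> and \<open>q^3\<close>,
    \<open>b\<close> collects \<open>q\<close> and \<open>q^4\<close>, and \<open>c\<close> collects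
    \<open>q^2\<close>. Only \<open>a\<close> survives the extraction.\<close>
  define a b c where "a = E 2 * (P\<^sup>2 * R\<^sup>2 + q * (2 * S\<^sup>2 * R * Q - 4 * P * S * Q\<^sup>2))"
    and "b = E 2 * (2 * P\<^sup>2 * R * Q - P * S * R\<^sup>2 + q * (4 * S\<^sup>2 * Q\<^sup>2))"
    and "c = E 2 * (4 * P\<^sup>2 * Q\<^sup>2 - 2 * P * S * R * Q + S\<^sup>2 * R\<^sup>2)"
  \<comment> \<open>The dilated sum and difference of cubes in \<open>G\<close> split off the linear
    factors \<open>psi\<close> and \<open>phi\<close>.\<close>
  have "V G = ((V P)\<^sup>2 - q * V P * V S + q\<^sup>2 * (V S)\<^sup>2) * ((V R)\<^sup>2 + 2 * q * V R * V Q + 4 * q\<^sup>2 * (V Q)\<^sup>2) * (psi * phi * V (E 1))"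
    unfolding G_def V psi phi by algebra
  hence "V G * D = ((V P)\<^sup>2 - q * V P * V S + q\<^sup>2 * (V S)\<^sup>2) * ((V R)\<^sup>2 + 2 * q * V R * V Q + 4 * q\<^sup>2 * (V Q)\<^sup>2) * V (E 2)"
    unfolding D[symmetric] by (simp only: mult_ac)
  also have "\<dots> = V a + q * V b + q\<^sup>2 * V c"
    unfolding a_def b_def c_def V by algebra
  finally have dec: "V G * D = (a oo fps_X ^ 3) + fps_X * (b oo fps_X ^ 3) + fps_X\<^sup>2 * (c oo fps_X ^ 3)"
    by (simp add: V_def q_def)
  have "G * Abs_fps (\<lambda>n. D $ (3 * n)) = a"
  proof (rule fps_ext)
    fix n
    have "(G * Abs_fps (\<lambda>n. D $ (3 * n))) $ n = (V G * D) $ (3 * n)"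
      unfolding V_def q_def by (rule trisect_mult_compose[symmetric])
    also have "\<dots> = a $ n" by (rule trisect_dissection[OF dec])
    finally show "(G * Abs_fps (\<lambda>n. D $ (3 * n))) $ n = a $ n" .
  qed
  thus ?thesis by (simp add: G_def D_def a_def mult_ac)
qed

section \<open>Cubic relations between \<open>f_1\<close>, \<open>f_2\<close>, \<open>f_3\<close>,
  \<open>f_6\<close> and their dilations\<close>

lemma psi_fps_dilate_mult_euler:
  "(psi_fps oo fps_X ^ 3) * euler_fps 3 = (euler_fps 6 :: 'a :: field fps)\<^sup>2"
  using arg_cong[OF psi_fps_mult_euler[where 'a = 'a], of "\<lambda>f. f oo fps_X ^ 3"]
  by (simp add: fps_compose_mult_distrib euler_fps_compose_X_power flip: fps_compose_power)

text \<open>\<open>P\<close> and \<open>S\<close> are replaced by quotients of Euler products and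
  the denominators are cleared. In this division-free form the relation is easily carried along
  \<open>q -> -q\<close> and \<open>q -> q^2\<close>.\<close>

lemma cubic_identity_psi_polynomial:
  fixes E :: "nat \<Rightarrow> complex fps"
  defines "E \<equiv> euler_fps"
  shows "(E 2 ^ 3 * E 3 ^ 9 + fps_X * E 1 ^ 3 * E 6 ^ 9) * E 1 = E 2 ^ 8 * E 3 ^ 4 * E 6"
proof -
  define P S :: "complex fps" where "P = theta_fps 3 2 1" and "S = psi_fps oo fps_X ^ 3"
  have P: "P * (E 1 * E 6) = E 2 * E 3 ^ 2"
    using theta_fps_3_2 by (simp add: P_def E_def mult.assoc)
  have S: "S * E 3 = E 6 ^ 2"
    using psi_fps_dilate_mult_euler by (simp add: S_def E_def)
  have H: "(P ^ 3 + fps_X * S ^ 3) * (E 1 ^ 4 * E 6 ^ 2) = E 2 ^ 8 * E 3"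
    using cubic_identity_psi by (simp add: P_def S_def E_def)
  \<comment> \<open>The auxiliary factor \<open>E 1 ^ 3 * E 6 ^ 2\<close> lets \<open>P\<close> and
    \<open>S\<close> be inserted without division; it is cancelled at the end.\<close>
  have "(E 2 ^ 3 * E 3 ^ 9 + fps_X * E 1 ^ 3 * E 6 ^ 9) * E 1 * (E 1 ^ 3 * E 6 ^ 2) =
      ((E 2 * E 3 ^ 2) ^ 3 * E 3 ^ 3 + fps_X * (E 6 ^ 2) ^ 3 * (E 1 * E 6) ^ 3) * (E 1 ^ 4 * E 6 ^ 2)"
    by algebra
  also have "\<dots> = (P ^ 3 + fps_X * S ^ 3) * (E 1 ^ 4 * E 6 ^ 2) * (E 1 * E 6 * E 3) ^ 3"
    unfolding P[symmetric] S[symmetric] by algebra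
  also have "\<dots> = E 2 ^ 8 * E 3 ^ 4 * E 6 * (E 1 ^ 3 * E 6 ^ 2)"
    unfolding H by algebra
  finally show ?thesis
    by (rule mult_right_cancel[THEN iffD1, rotated]) (simp add: E_def euler_fps_nonzero)
qed

lemma cubic_identity_phi_polynomial:
  fixes E :: "nat \<Rightarrow> complex fps"
  defines "E \<equiv> euler_fps"
  shows "(E 2 ^ 3 * E 3 ^ 9 - 8 * fps_X * E 1 ^ 3 * E 6 ^ 9) * E 2 = E 1 ^ 8 * E 6 ^ 4 * E 3"
proof -
  define Q R :: "complex fps" where "Q = theta_fps 6 5 (-1)" and "R = theta_fps 6 3 (-1)"
  have Q: "Q * (E 2 * E 3) = E 1 * E 6 ^ 2"
    using theta_fps_6_5_minus by (simp add: Q_def E_def mult.assoc)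
  have R: "R * E 6 = E 3 ^ 2"
    using theta_fps_6_3_minus by (simp add: R_def E_def)
  have H: "(R ^ 3 - 8 * fps_X * Q ^ 3) * (E 2 ^ 4 * E 3 ^ 2) = E 1 ^ 8 * E 6"
    using cubic_identity_phi by (simp add: Q_def R_def E_def)
  have "(E 2 ^ 3 * E 3 ^ 9 - 8 * fps_X * E 1 ^ 3 * E 6 ^ 9) * E 2 * (E 2 ^ 3 * E 3 ^ 2) =
      ((E 3 ^ 2) ^ 3 * (E 2 * E 3) ^ 3 - 8 * fps_X * (E 1 * E 6 ^ 2) ^ 3 * E 6 ^ 3) * (E 2 ^ 4 * E 3 ^ 2)"
    by algebra
  also have "\<dots> = (R ^ 3 - 8 * fps_X * Q ^ 3) * (E 2 ^ 4 * E 3 ^ 2) * (E 2 * E 3 * E 6) ^ 3"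
    unfolding Q[symmetric] R[symmetric] by algebra
  also have "\<dots> = E 1 ^ 8 * E 6 ^ 4 * E 3 * (E 2 ^ 3 * E 3 ^ 2)"
    unfolding H by algebra
  finally show ?thesis
    by (rule mult_right_cancel[THEN iffD1, rotated]) (simp add: E_def euler_fps_nonzero)
qed

lemma cubic_identity_psi_dilated:
  fixes E :: "nat \<Rightarrow> complex fps"
  defines "E \<equiv> euler_fps"
  shows "(E 4 ^ 3 * E 6 ^ 9 + fps_X\<^sup>2 * E 2 ^ 3 * E 12 ^ 9) * E 2 = E 4 ^ 8 * E 6 ^ 4 * E 12"
  unfolding E_def
  using arg_cong[OF cubic_identity_psi_polynomial, of "\<lambda>f. f oo fps_X\<^sup>2"]
  by (simp add: euler_fps_compose_X_power[of _ 2] fps_compose_add_distrib fps_compose_mult_distrib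
      flip: fps_compose_power)

lemma cubic_identity_phi_dilated:
  fixes E :: "nat \<Rightarrow> complex fps"
  defines "E \<equiv> euler_fps"
  shows "(E 4 ^ 3 * E 6 ^ 9 - 8 * fps_X\<^sup>2 * E 2 ^ 3 * E 12 ^ 9) * E 4 = E 2 ^ 8 * E 12 ^ 4 * E 6"
  unfolding E_def
  using arg_cong[OF cubic_identity_phi_polynomial, of "\<lambda>f. f oo fps_X\<^sup>2"]
  by (simp add: euler_fps_compose_X_power[of _ 2] fps_compose_sub_distrib fps_compose_mult_distrib
      flip: fps_compose_power)

section \<open>Identities of level 12\<close>

text \<open>Here \<open>a1\<close>, \<open>a2\<close> etc. stand for \<open>f_k(q)\<close> and
  \<open>b1\<close>, \<open>b3\<close> for \<open>f_k(-q)\<close>, so \<open>C - C'\<close> is twice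
  the odd part of \<open>C\<close>. The values of \<open>C * C'\<close> and
  \<open>C^3 - C'^3\<close> give a cubic equation for it, which \<open>2*q*B\<close> satisfies as
  well.\<close>

lemma level_12_field_identity:
  fixes q :: "'a :: field"
  assumes nz: "a1 \<noteq> 0" "a2 \<noteq> 0" "a3 \<noteq> 0" "a4 \<noteq> 0" "a6 \<noteq> 0" "a12 \<noteq> 0" "b1 \<noteq> 0" "b3 \<noteq> 0" "q \<noteq> 0"
  assumes b: "a1 * b1 * a4 = a2 ^ 3" "a3 * b3 * a12 = a6 ^ 3"
  assumes H1: "(a2 ^ 3 * a3 ^ 9 + q * a1 ^ 3 * a6 ^ 9) * a1 = a2 ^ 8 * a3 ^ 4 * a6"
  assumes H1': "(a2 ^ 3 * b3 ^ 9 - q * b1 ^ 3 * a6 ^ 9) * b1 = a2 ^ 8 * b3 ^ 4 * a6"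
  assumes H1sq: "(a4 ^ 3 * a6 ^ 9 + q\<^sup>2 * a2 ^ 3 * a12 ^ 9) * a2 = a4 ^ 8 * a6 ^ 4 * a12"
  assumes H2sq: "(a4 ^ 3 * a6 ^ 9 - 8 * q\<^sup>2 * a2 ^ 3 * a12 ^ 9) * a4 = a2 ^ 8 * a12 ^ 4 * a6"
  defines "C \<equiv> a3 ^ 3 / a1" and "C' \<equiv> b3 ^ 3 / b1"
    and "A \<equiv> a4 ^ 3 * a6\<^sup>2 / (a2\<^sup>2 * a12)" and "B \<equiv> a12 ^ 3 / a4"
  shows "C * C' = A\<^sup>2 - q\<^sup>2 * B\<^sup>2"
    and "(C - C') ^ 3 + 3 * (C * C') * (C - C') = (2 * q * B) ^ 3 + 3 * (C * C') * (2 * q * B)"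
proof -
  have b1: "b1 = a2 ^ 3 / (a1 * a4)" and b3: "b3 = a6 ^ 3 / (a3 * a12)"
    using b nz by (auto simp: field_simps)
  define M where "M = C * C'"
  have M: "M = a6 ^ 9 * a4 / (a12 ^ 3 * a2 ^ 3)"
    using nz by (simp add: M_def C_def C'_def b1 b3 field_simps, algebra?)
  have eA: "A * (a2\<^sup>2 * a12) = a4 ^ 3 * a6\<^sup>2" and eB: "B * a4 = a12 ^ 3"
    and eC: "C * a1 = a3 ^ 3" and eC': "C' * b1 = b3 ^ 3" and eM: "M * (a12 ^ 3 * a2 ^ 3) = a6 ^ 9 * a4"
    using nz by (simp_all add: A_def B_def C_def C'_def M)
  have F: "(A\<^sup>2 - q\<^sup>2 * B\<^sup>2) * (a2 ^ 4 * a4\<^sup>2 * a12 ^ 3) =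
      (A * (a2\<^sup>2 * a12))\<^sup>2 * a4\<^sup>2 * a12 - q\<^sup>2 * (B * a4)\<^sup>2 * a2 ^ 4 * a12 ^ 3" by algebra
  have "M * (a2 ^ 4 * a4\<^sup>2 * a12 ^ 3) = (A\<^sup>2 - q\<^sup>2 * B\<^sup>2) * (a2 ^ 4 * a4\<^sup>2 * a12 ^ 3)"
  proof -
    have "M * (a2 ^ 4 * a4\<^sup>2 * a12 ^ 3) = M * (a12 ^ 3 * a2 ^ 3) * a2 * a4\<^sup>2" by algebra
    also have "\<dots> = a4 ^ 8 * a6 ^ 4 * a12 - q\<^sup>2 * a2 ^ 4 * a12 ^ 9"
      unfolding eM using H1sq by algebra
    also have "\<dots> = (a4 ^ 3 * a6\<^sup>2)\<^sup>2 * a4\<^sup>2 * a12 - q\<^sup>2 * (a12 ^ 3)\<^sup>2 * a2 ^ 4 * a12 ^ 3" by algebra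
    also have "\<dots> = (A\<^sup>2 - q\<^sup>2 * B\<^sup>2) * (a2 ^ 4 * a4\<^sup>2 * a12 ^ 3)"
      unfolding F eA eB ..
    finally show ?thesis .
  qed
  hence AB: "M = A\<^sup>2 - q\<^sup>2 * B\<^sup>2"
    by (rule mult_right_cancel[THEN iffD1, rotated]) (use nz in simp)
  thus "C * C' = A\<^sup>2 - q\<^sup>2 * B\<^sup>2" by (simp add: M_def)
  \<comment> \<open>These monomials are the values of \<open>A^2 - 9*q^2*B^2\<close>,
    \<open>C^3 + q*M*B\<close> and \<open>C'^3 - q*M*B\<close>, read off from \<open>H2sq\<close>,
    \<open>H1\<close> and \<open>H1'\<close>. Being monomials, they can be compared by
    multiplication: \<open>K1 * K2 = M * A^2 * L\<close>.\<close>
  define L K1 K2 where "L = a2 ^ 5 * a6 * a12 / a4 ^ 3"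
    and "K1 = a2 ^ 5 * a3 ^ 4 * a6 / a1 ^ 4" and "K2 = a2 ^ 5 * b3 ^ 4 * a6 / b1 ^ 4"
  have eL: "L * a4 ^ 3 = a2 ^ 5 * a6 * a12"
    and eK1: "K1 * a1 ^ 4 = a2 ^ 5 * a3 ^ 4 * a6" and eK2: "K2 * b1 ^ 4 = a2 ^ 5 * b3 ^ 4 * a6"
    using nz by (simp_all add: L_def K1_def K2_def)
  have G: "M * B * a2 ^ 3 = a6 ^ 9" using nz by (simp add: M B_def)
  have L: "A\<^sup>2 - 9 * q\<^sup>2 * B\<^sup>2 = L"
  proof -
    have "(A\<^sup>2 - 9 * q\<^sup>2 * B\<^sup>2) * (a12 ^ 3 * a2 ^ 3 * a4 ^ 3) =
        M * (a12 ^ 3 * a2 ^ 3) * a4 ^ 3 - 8 * q\<^sup>2 * (B * a4)\<^sup>2 * a12 ^ 3 * a2 ^ 3 * a4"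
      unfolding AB by algebra
    also have "\<dots> = (a4 ^ 3 * a6 ^ 9 - 8 * q\<^sup>2 * a2 ^ 3 * a12 ^ 9) * a4"
      unfolding eM eB by algebra
    also have "\<dots> = L * a4 ^ 3 * (a12 ^ 3 * a2 ^ 3)"
      unfolding H2sq eL by algebra
    also have "\<dots> = L * (a12 ^ 3 * a2 ^ 3 * a4 ^ 3)" by algebra
    finally show ?thesis
      by (rule mult_right_cancel[THEN iffD1, rotated]) (use nz in simp)
  qed
  have K1: "C ^ 3 + q * (M * B) = K1"
  proof -
    have "(C ^ 3 + q * (M * B)) * (a1 ^ 4 * a2 ^ 3) = (C * a1) ^ 3 * a1 * a2 ^ 3 + q * (M * B * a2 ^ 3) * a1 ^ 4"
      by algebra
    also have "\<dots> = (a2 ^ 3 * a3 ^ 9 + q * a1 ^ 3 * a6 ^ 9) * a1" unfolding eC G by algebra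
    also have "\<dots> = K1 * a1 ^ 4 * a2 ^ 3" unfolding H1 eK1 by algebra
    also have "\<dots> = K1 * (a1 ^ 4 * a2 ^ 3)" by algebra
    finally show ?thesis
      by (rule mult_right_cancel[THEN iffD1, rotated]) (use nz in simp)
  qed
  have K2: "C' ^ 3 - q * (M * B) = K2"
  proof -
    have "(C' ^ 3 - q * (M * B)) * (b1 ^ 4 * a2 ^ 3) = (C' * b1) ^ 3 * b1 * a2 ^ 3 - q * (M * B * a2 ^ 3) * b1 ^ 4"
      by algebra
    also have "\<dots> = (a2 ^ 3 * b3 ^ 9 - q * b1 ^ 3 * a6 ^ 9) * b1" unfolding eC' G by algebra
    also have "\<dots> = K2 * b1 ^ 4 * a2 ^ 3" unfolding H1' eK2 by algebra
    also have "\<dots> = K2 * (b1 ^ 4 * a2 ^ 3)" by algebra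
    finally show ?thesis
      by (rule mult_right_cancel[THEN iffD1, rotated]) (use nz in simp)
  qed
  have KK: "K1 * K2 = M * A\<^sup>2 * L"
  proof -
    have "K1 * K2 * (a2 ^ 12 * (a12 ^ 5 * a4 ^ 3)) = K1 * K2 * ((a2 ^ 3) ^ 4 * (a12 ^ 5 * a4 ^ 3))" by algebra
    also have "\<dots> = K1 * a1 ^ 4 * (K2 * b1 ^ 4) * (a4 ^ 7 * a12 ^ 5)"
      unfolding b(1)[symmetric] by algebra
    also have "\<dots> = a2 ^ 10 * a6\<^sup>2 * (a3 * b3 * a12) ^ 4 * (a4 ^ 7 * a12)"
      unfolding eK1 eK2 by algebra
    also have "\<dots> = a6 ^ 9 * a4 * (a4 ^ 3 * a6\<^sup>2)\<^sup>2 * (a2 ^ 5 * a6 * a12) * a2 ^ 5"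
      unfolding b(2) by algebra
    also have "\<dots> = M * A\<^sup>2 * L * (a2 ^ 12 * (a12 ^ 5 * a4 ^ 3))"
      unfolding eM[symmetric] eA[symmetric] eL[symmetric] by algebra
    finally show ?thesis
      by (rule mult_right_cancel[THEN iffD1, rotated]) (use nz in simp)
  qed
  \<comment> \<open>Expanding \<open>K1 * K2\<close> with \<open>C * C' = M\<close> isolates the
    difference of cubes. With \<open>M\<close> and \<open>L\<close> written in \<open>A\<close> and
    \<open>q*B\<close>, the common factor \<open>q*M*B\<close> then cancels.\<close>
  have "q * (M * B) * (C ^ 3 - C' ^ 3) = M ^ 3 - q\<^sup>2 * (M * B)\<^sup>2 - K1 * K2"
    unfolding K1[symmetric] K2[symmetric] M_def by algebra
  also have "\<dots> = q * (M * B) * ((A + q * B) ^ 3 - (A - q * B) ^ 3)"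
    unfolding KK L[symmetric] AB by algebra
  finally have "C ^ 3 - C' ^ 3 = (A + q * B) ^ 3 - (A - q * B) ^ 3"
    by (rule mult_left_cancel[THEN iffD1, rotated]) (use nz in \<open>simp add: M B_def\<close>)
  moreover have "(C - C') ^ 3 + 3 * (C * C') * (C - C') = C ^ 3 - C' ^ 3" by algebra
  \<comment> \<open>\<open>A + q*B\<close> and \<open>A - q*B\<close> have product \<open>M\<close>
    and difference \<open>2*q*B\<close>, so \<open>2*q*B\<close> satisfies the same cubic as
    \<open>C - C'\<close>.\<close>
  moreover have "(A + q * B) ^ 3 - (A - q * B) ^ 3 = (2 * q * B) ^ 3 + 3 * M * (2 * q * B)"
    unfolding AB by algebra
  ultimately show "(C - C') ^ 3 + 3 * (C * C') * (C - C') = (2 * q * B) ^ 3 + 3 * (C * C') * (2 * q * B)"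
    by (simp only: M_def)
qed

text \<open>As \<open>(A + q*B) * (A - q*B)\<close> is a monomial, the subtracted term also becomes
  a multiple of \<open>a3^3\<close>. Then
  \<open>(A + q*B)^2 - 2*q*B*(A - q*B) = A^2 + 3*q^2*B^2\<close>, which is \<open>a2^6\<close> times
  the bracket on the right.\<close>

lemma final_field_identity:
  fixes q :: "'a :: field"
  assumes nz: "a1 \<noteq> 0" "a2 \<noteq> 0" "a3 \<noteq> 0" "a4 \<noteq> 0" "a6 \<noteq> 0" "a12 \<noteq> 0"
  assumes C: "a3 ^ 3 / a1 = a4 ^ 3 * a6\<^sup>2 / (a2\<^sup>2 * a12) + q * (a12 ^ 3 / a4)"
  assumes H1sq: "(a4 ^ 3 * a6 ^ 9 + q\<^sup>2 * a2 ^ 3 * a12 ^ 9) * a2 = a4 ^ 8 * a6 ^ 4 * a12"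
  shows "a3 ^ 9 / (a1 ^ 7 * a2 * a6 ^ 3) - 2 * q * a6 ^ 6 / (a1 ^ 4 * a2 ^ 4) =
    a2 ^ 5 * a3 ^ 3 / (a1 ^ 5 * a6 ^ 3) *
      (a4 ^ 6 * a6 ^ 4 / (a2 ^ 10 * a12\<^sup>2) + 3 * q\<^sup>2 * (a12 ^ 6 / (a2 ^ 6 * a4\<^sup>2)))"
proof -
  define A B where "A = a4 ^ 3 * a6\<^sup>2 / (a2\<^sup>2 * a12)" and "B = a12 ^ 3 / a4"
  have C': "a3 ^ 3 = a1 * (A + q * B)"
    using C nz by (simp add: A_def B_def divide_eq_eq mult.commute)
  have D: "A\<^sup>2 - q\<^sup>2 * B\<^sup>2 = a6 ^ 9 * a4 / (a12 ^ 3 * a2 ^ 3)"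
  proof -
    have e: "A * (a2\<^sup>2 * a12) = a4 ^ 3 * a6\<^sup>2" "B * a4 = a12 ^ 3"
      using nz by (simp_all add: A_def B_def)
    have "(A\<^sup>2 - q\<^sup>2 * B\<^sup>2) * (a2 ^ 4 * a4\<^sup>2 * a12 ^ 3) =
        (A * (a2\<^sup>2 * a12))\<^sup>2 * a4\<^sup>2 * a12 - q\<^sup>2 * (B * a4)\<^sup>2 * a2 ^ 4 * a12 ^ 3" by algebra
    also have "\<dots> = a4 ^ 8 * a6 ^ 4 * a12 - q\<^sup>2 * a2 ^ 4 * a12 ^ 9" unfolding e by algebra
    also have "\<dots> = a6 ^ 9 * a4 ^ 3 * a2" using H1sq by algebra
    also have "\<dots> = a6 ^ 9 * a4 / (a12 ^ 3 * a2 ^ 3) * (a2 ^ 4 * a4\<^sup>2 * a12 ^ 3)"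
      using nz by (simp add: field_simps, algebra?)
    finally show ?thesis
      by (rule mult_right_cancel[THEN iffD1, rotated]) (use nz in simp)
  qed
  have BD: "B * (A - q * B) * a3 ^ 3 = a1 * a6 ^ 9 / a2 ^ 3"
  proof -
    have "B * (A - q * B) * a3 ^ 3 = a1 * (B * (A\<^sup>2 - q\<^sup>2 * B\<^sup>2))"
      unfolding C' by algebra
    thus ?thesis unfolding D using nz by (simp add: B_def field_simps)
  qed
  have "a3 ^ 9 / (a1 ^ 7 * a2 * a6 ^ 3) - 2 * q * a6 ^ 6 / (a1 ^ 4 * a2 ^ 4) =
      (a3 ^ 9 / a1\<^sup>2 - 2 * q * (a1 * a6 ^ 9 / a2 ^ 3)) / (a1 ^ 5 * a2 * a6 ^ 3)"
    using nz by (simp add: field_simps, algebra?)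
  also have "a3 ^ 9 / a1\<^sup>2 = a3 ^ 3 * (A + q * B)\<^sup>2"
  proof -
    have "a3 ^ 9 = a3 ^ 3 * (a3 ^ 3)\<^sup>2" by algebra
    also have "\<dots> = a3 ^ 3 * (A + q * B)\<^sup>2 * a1\<^sup>2" unfolding C' by algebra
    finally show ?thesis using nz by (subst nonzero_divide_eq_eq) auto
  qed
  also have "a3 ^ 3 * (A + q * B)\<^sup>2 - 2 * q * (a1 * a6 ^ 9 / a2 ^ 3) = a3 ^ 3 * (A\<^sup>2 + 3 * q\<^sup>2 * B\<^sup>2)"
    unfolding BD[symmetric] by algebra
  also have "a3 ^ 3 * (A\<^sup>2 + 3 * q\<^sup>2 * B\<^sup>2) / (a1 ^ 5 * a2 * a6 ^ 3) =
     a2 ^ 5 * a3 ^ 3 / (a1 ^ 5 * a6 ^ 3) * ((A\<^sup>2 + 3 * q\<^sup>2 * B\<^sup>2) / a2 ^ 6)"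
    using nz by (simp add: divide_simps, algebra?)
  also have "(A\<^sup>2 + 3 * q\<^sup>2 * B\<^sup>2) / a2 ^ 6 =
      a4 ^ 6 * a6 ^ 4 / (a2 ^ 10 * a12\<^sup>2) + 3 * q\<^sup>2 * (a12 ^ 6 / (a2 ^ 6 * a4\<^sup>2))"
    unfolding A_def B_def using nz by (simp add: divide_simps, algebra?)
  finally show ?thesis .
qed

section \<open>The 2-dissection of \<open>f_3^3 / f_1\<close>\<close>

lemma fps_to_fls_divide_unit:
  fixes f g :: "'a :: field fps"
  assumes "g $ 0 \<noteq> 0"
  shows "fps_to_fls (f / g) = fps_to_fls f / fps_to_fls g"
proof -
  have "fps_to_fls (f / g) * fps_to_fls g = fps_to_fls (f * (inverse g * g))"
    using assms by (simp add: fps_divide_unit fls_times_fps_to_fls mult.assoc)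
  moreover have "g \<noteq> 0" using assms by auto
  ultimately show ?thesis
    using assms by (simp add: nonzero_eq_divide_eq inverse_mult_eq_1)
qed

lemma fps_divide_unit_nth_0:
  fixes f g :: "'a :: field fps"
  assumes "g $ 0 = 1"
  shows "(f / g) $ 0 = f $ 0"
  using assms by (simp add: fps_divide_unit)

lemma euler_fps_3_compose_uminus_X:
  fixes E :: "nat \<Rightarrow> 'a :: field fps"
  defines "E \<equiv> euler_fps"
  shows "E 3 * (E 3 oo - fps_X) * E 12 = E 6 ^ 3"
proof -
  let ?X = "fps_X :: 'a fps"
  \<comment> \<open>As 3 is odd, the dilation \<open>q -> q^3\<close> commutes with
    \<open>q -> -q\<close>.\<close>
  have "(E 1 oo - ?X) oo ?X ^ 3 = E 1 oo (- ?X oo ?X ^ 3)"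
    by (rule fps_compose_assoc[symmetric]) auto
  also have "\<dots> = E 1 oo - (?X ^ 3)"
    by (simp add: fps_compose_uminus)
  also have "\<dots> = E 3 oo - ?X"
    unfolding E_def by (subst (1 2) euler_fps_compose) auto
  finally have 1: "(E 1 oo - ?X) oo ?X ^ 3 = E 3 oo - ?X" .
  have "(E 1 * (E 1 oo - ?X) * E 4) oo ?X ^ 3 = E 2 ^ 3 oo ?X ^ 3"
    unfolding E_def euler_fps_compose_uminus_X ..
  hence "(E 1 oo ?X ^ 3) * ((E 1 oo - ?X) oo ?X ^ 3) * (E 4 oo ?X ^ 3) = (E 2 oo ?X ^ 3) ^ 3"
    by (simp add: fps_compose_mult_distrib flip: fps_compose_power)
  thus ?thesis
    unfolding 1 by (simp add: E_def euler_fps_compose_X_power)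
qed

text \<open>
  The difference of the two sides of a depressed cubic factors as
  \<open>(d - e) * (d\<^sup>2 + d * e + e\<^sup>2 + 3 * m)\<close>, and the second factor has constant term \<open>3 * m $ 0\<close>.
\<close>

lemma depressed_cubic_unique_fps:
  fixes d e m :: "'a :: field_char_0 fps"
  assumes "d ^ 3 + 3 * m * d = e ^ 3 + 3 * m * e"
    and "d $ 0 = 0" "e $ 0 = 0" "m $ 0 \<noteq> 0"
  shows "d = e"
proof -
  have "(d - e) * (d * d + d * e + e * e + 3 * m) = 0"
    using assms(1) by algebra
  moreover have "(d * d + d * e + e * e + 3 * m) $ 0 \<noteq> 0"
    using assms by simp
  hence "d * d + d * e + e * e + 3 * m \<noteq> 0" by (metis fps_zero_nth)
  ultimately show ?thesis by (metis mult_eq_0_iff eq_iff_diff_eq_0)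
qed

lemma euler_fps_2_dissection:
  fixes E :: "nat \<Rightarrow> complex fps"
  defines "E \<equiv> euler_fps"
  shows "E 3 ^ 3 / E 1 = E 4 ^ 3 * (E 6)\<^sup>2 / ((E 2)\<^sup>2 * E 12) + fps_X * (E 12 ^ 3 / E 4)"
proof -
  let ?X = "fps_X :: complex fps"
  define T where "T = (\<lambda>k. E k oo - ?X)"
  define C C' A B where "C = E 3 ^ 3 / E 1" and "C' = T 3 ^ 3 / T 1"
    and "A = E 4 ^ 3 * (E 6)\<^sup>2 / ((E 2)\<^sup>2 * E 12)" and "B = E 12 ^ 3 / E 4"
  have E0: "E k $ 0 = 1" "T k $ 0 = 1" if "k > 0" for k
    using that by (simp_all add: E_def T_def euler_fps_nth_0)
  have P0: "(f ^ n) $ 0 = (f $ 0) ^ n" for f :: "complex fps" and n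
    by (induction n) auto
  have C0: "C $ 0 = 1" "C' $ 0 = 1" "A $ 0 = 1"
    by (simp_all add: C_def C'_def A_def fps_divide_unit_nth_0 E0 P0)
  have b: "E 1 * T 1 * E 4 = E 2 ^ 3" "E 3 * T 3 * E 12 = E 6 ^ 3"
    using euler_fps_compose_uminus_X euler_fps_3_compose_uminus_X by (simp_all add: E_def T_def)
  have H1: "(E 2 ^ 3 * E 3 ^ 9 + ?X * E 1 ^ 3 * E 6 ^ 9) * E 1 = E 2 ^ 8 * E 3 ^ 4 * E 6"
    using cubic_identity_psi_polynomial by (simp add: E_def)
  have H1': "(E 2 ^ 3 * T 3 ^ 9 - ?X * T 1 ^ 3 * E 6 ^ 9) * T 1 = E 2 ^ 8 * T 3 ^ 4 * E 6"
  proof -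
    have "E 2 oo - ?X = E 2" "E 6 oo - ?X = E 6"
      by (simp_all add: E_def euler_fps_even_compose_uminus_X)
    moreover have "((E 2 ^ 3 * E 3 ^ 9 + ?X * E 1 ^ 3 * E 6 ^ 9) * E 1) oo - ?X = (E 2 ^ 8 * E 3 ^ 4 * E 6) oo - ?X"
      unfolding H1 ..
    ultimately show ?thesis
      by (simp add: T_def fps_compose_add_distrib fps_compose_mult_distrib flip: fps_compose_power)
  qed
  have H1sq: "(E 4 ^ 3 * E 6 ^ 9 + ?X\<^sup>2 * E 2 ^ 3 * E 12 ^ 9) * E 2 = E 4 ^ 8 * E 6 ^ 4 * E 12"
    using cubic_identity_psi_dilated by (simp add: E_def)
  have H2sq: "(E 4 ^ 3 * E 6 ^ 9 - 8 * ?X\<^sup>2 * E 2 ^ 3 * E 12 ^ 9) * E 4 = E 2 ^ 8 * E 12 ^ 4 * E 6"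
    using cubic_identity_phi_dilated by (simp add: E_def)
  \<comment> \<open>The field identities apply in the field of Laurent series; all denominators are
    power series with constant term 1, so the embedding respects the quotients.\<close>
  let ?f = "fps_to_fls :: complex fps \<Rightarrow> complex fls"
  note hom = fls_times_fps_to_fls fps_to_fls_power
  have nz: "?f (E k) \<noteq> 0" "?f (T k) \<noteq> 0" if "k > 0" for k
    using E0[OF that] by auto
  have div: "?f C = ?f (E 3) ^ 3 / ?f (E 1)" "?f C' = ?f (T 3) ^ 3 / ?f (T 1)"
    "?f A = ?f (E 4) ^ 3 * ?f (E 6) ^ 2 / (?f (E 2) ^ 2 * ?f (E 12))" "?f B = ?f (E 12) ^ 3 / ?f (E 4)"
    by (simp_all add: C_def C'_def A_def B_def fps_to_fls_divide_unit E0 P0 hom)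
  note fH = b[THEN arg_cong, of ?f] H1[THEN arg_cong, of ?f] H1'[THEN arg_cong, of ?f]
    H1sq[THEN arg_cong, of ?f] H2sq[THEN arg_cong, of ?f]
  note fH = fH[unfolded hom fps_to_fls_plus fps_to_fls_minus fps_to_fls_numeral]
  have X: "?f ?X \<noteq> 0" by simp
  note lev = level_12_field_identity[OF nz(1) nz(1) nz(1) nz(1) nz(1) nz(1) nz(2) nz(2) X fH(1-6), folded div]
  have "?f (C * C') = ?f (A\<^sup>2 - ?X\<^sup>2 * B\<^sup>2)"
    using lev(1) by (simp add: hom)
  hence CC: "C * C' = A\<^sup>2 - ?X\<^sup>2 * B\<^sup>2" by (simp only: fps_to_fls_eq_iff)
  have "?f ((C - C') ^ 3 + 3 * (C * C') * (C - C')) =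
      ?f ((2 * ?X * B) ^ 3 + 3 * (C * C') * (2 * ?X * B))"
    using lev(2) by (simp only: hom fps_to_fls_plus fps_to_fls_minus fps_to_fls_numeral zero_less_numeral zero_less_one simp_thms)
  \<comment> \<open>Both \<open>C - C'\<close> and \<open>2*X*B\<close> have constant term 0 and
    \<open>C * C'\<close> has constant term 1, as the uniqueness for the cubic requires.\<close>
  hence "C - C' = 2 * ?X * B"
    unfolding fps_to_fls_eq_iff by (rule depressed_cubic_unique_fps) (simp_all add: C0)
  \<comment> \<open>Inserting \<open>C' = C - 2*X*B\<close> gives \<open>(C - X*B)^2 = A^2\<close>;
    the sign is decided by the constant terms of \<open>C - X*B\<close> and \<open>A\<close>, which
    are both 1.\<close>
  hence "(C - ?X * B - A) * (C - ?X * B + A) = 0"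
    using CC by algebra
  moreover have "(C - ?X * B + A) $ 0 \<noteq> 0" by (simp add: C0)
  hence "C - ?X * B + A \<noteq> 0" by (metis fps_zero_nth)
  ultimately have "C - ?X * B - A = 0" by (metis mult_eq_0_iff)
  hence "C = A + ?X * B" by (simp add: diff_eq_eq add.commute)
  thus ?thesis by (simp only: C_def A_def B_def)
qed

section \<open>Closed form of the trisected series and the theorem\<close>

lemma trisected_PD_field:
  fixes q :: "'a :: field"
  assumes nz: "a1 \<noteq> 0" "a2 \<noteq> 0" "a3 \<noteq> 0" "a6 \<noteq> 0"
  assumes "P * (a1 * a6) = a2 * a3\<^sup>2" "S * a3 = a6\<^sup>2" "R * a6 = a3\<^sup>2" "Q * (a2 * a3) = a1 * a6\<^sup>2"
    and "(P ^ 3 + q * S ^ 3) * (a1 ^ 4 * a6 ^ 2) = a2 ^ 8 * a3"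
    and "(R ^ 3 - 8 * q * Q ^ 3) * (a2 ^ 4 * a3 ^ 2) = a1 ^ 8 * a6"
    and "U * (P ^ 3 + q * S ^ 3) * (R ^ 3 - 8 * q * Q ^ 3) * a1 =
      a2 * (P\<^sup>2 * R\<^sup>2 + q * (2 * S\<^sup>2 * R * Q - 4 * P * S * Q\<^sup>2))"
  shows "U = a3 ^ 9 / (a1 ^ 7 * a2 * a6 ^ 3) - 2 * q * a6 ^ 6 / (a1 ^ 4 * a2 ^ 4)"
proof -
  have vals: "P = a2 * a3\<^sup>2 / (a1 * a6)" "S = a6\<^sup>2 / a3" "R = a3\<^sup>2 / a6" "Q = a1 * a6\<^sup>2 / (a2 * a3)"
    using assms by (simp_all add: nonzero_eq_divide_eq)
  have PR: "P\<^sup>2 * R\<^sup>2 = a2\<^sup>2 * a3 ^ 8 / (a1\<^sup>2 * a6 ^ 4)"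
    unfolding vals using nz by (simp add: divide_simps, algebra?)
  \<comment> \<open>This product coincides with \<open>P * S * Q^2\<close>, so the coefficients 2
    and -4 combine to the -2 of the result.\<close>
  have SRQ: "S\<^sup>2 * R * Q = a1 * a6 ^ 5 / (a2 * a3)"
    unfolding vals using nz by (simp add: divide_simps, algebra?)
  have PSQ: "P * S * Q\<^sup>2 = a1 * a6 ^ 5 / (a2 * a3)"
    unfolding vals using nz by (simp add: divide_simps, algebra?)
  have "U * (a1 ^ 9 * a2 ^ 8 * a3 * a6) = U * (a2 ^ 8 * a3) * (a1 ^ 8 * a6) * a1"
    by algebra
  also have "\<dots> = (U * (P ^ 3 + q * S ^ 3) * (R ^ 3 - 8 * q * Q ^ 3) * a1) * ((a1 ^ 4 * a6 ^ 2) * (a2 ^ 4 * a3 ^ 2))"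
    unfolding assms(9,10)[symmetric] by (simp only: mult_ac)
  also have "\<dots> = a2 * (P\<^sup>2 * R\<^sup>2 + q * (2 * (S\<^sup>2 * R * Q) - 4 * (P * S * Q\<^sup>2))) * ((a1 ^ 4 * a6 ^ 2) * (a2 ^ 4 * a3 ^ 2))"
    unfolding assms(11) by (simp only: mult.assoc)
  also have "\<dots> = (a3 ^ 9 / (a1 ^ 7 * a2 * a6 ^ 3) - 2 * q * a6 ^ 6 / (a1 ^ 4 * a2 ^ 4)) * (a1 ^ 9 * a2 ^ 8 * a3 * a6)"
    unfolding PR SRQ PSQ using nz by (simp add: divide_simps, algebra?)
  finally show ?thesis
    by (rule mult_right_cancel[THEN iffD1, rotated]) (use nz in simp)
qed

theorem theorem1p5:
  fixes q :: "complex fps"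
  defines "q \<equiv> fps_X"
  shows "Abs_fps (\<lambda>n. of_nat (PD (3 * n))) =
    1 / ((q; q^6)\<^sub>\<infinity> ^ 5 * (q^3; q^6)\<^sub>\<infinity> ^ 2 * (q^5; q^6)\<^sub>\<infinity> ^ 5) *
    ((q^4; q^4)\<^sub>\<infinity> ^ 6 * (q^6; q^6)\<^sub>\<infinity> ^ 4 /
       ((q^2; q^2)\<^sub>\<infinity> ^ 10 * (q^12; q^12)\<^sub>\<infinity> ^ 2)
     + 3 * q^2 * ((q^12; q^12)\<^sub>\<infinity> ^ 6 /
       ((q^2; q^2)\<^sub>\<infinity> ^ 6 * (q^4; q^4)\<^sub>\<infinity> ^ 2)))"
proof -
  define E where "E = (euler_fps :: nat \<Rightarrow> complex fps)"
  define P S R Q U where "P = (theta_fps 3 2 1 :: complex fps)" and "S = (psi_fps oo fps_X ^ 3 :: complex fps)"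
    and "R = (theta_fps 6 3 (-1) :: complex fps)" and "Q = (theta_fps 6 5 (-1) :: complex fps)"
    and "U = (Abs_fps (\<lambda>n. of_nat (PD (3 * n))) :: complex fps)"
  define u where "u = (\<lambda>a. (q ^ a; q ^ 6)\<^sub>\<infinity>)"
  have E0: "E k $ 0 = 1" if "k > 0" for k
    using that by (simp add: E_def euler_fps_nth_0)
  have u0: "u k $ 0 = 1" if "k > 0" for k
    unfolding u_def q_def using that by (intro qpochhammer_inf_nth_0) auto
  have P0: "(f ^ n) $ 0 = (f $ 0) ^ n" for f :: "complex fps" and n
    by (induction n) auto
  let ?f = "fps_to_fls :: complex fps \<Rightarrow> complex fls"
  note hom = fls_times_fps_to_fls fps_to_fls_power fps_to_fls_plus fps_to_fls_minus fps_to_fls_numeral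
  have nz: "?f (E k) \<noteq> 0" if "k > 0" for k
    using E0[OF that] by auto
  have eqs: "P * (E 1 * E 6) = E 2 * (E 3)\<^sup>2" "S * E 3 = (E 6)\<^sup>2" "R * E 6 = (E 3)\<^sup>2" "Q * (E 2 * E 3) = E 1 * (E 6)\<^sup>2"
    "(P ^ 3 + q * S ^ 3) * (E 1 ^ 4 * E 6 ^ 2) = E 2 ^ 8 * E 3"
    "(R ^ 3 - 8 * q * Q ^ 3) * (E 2 ^ 4 * E 3 ^ 2) = E 1 ^ 8 * E 6"
    "U * (P ^ 3 + q * S ^ 3) * (R ^ 3 - 8 * q * Q ^ 3) * E 1 =
      E 2 * (P\<^sup>2 * R\<^sup>2 + q * (2 * S\<^sup>2 * R * Q - 4 * P * S * Q\<^sup>2))"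
    using theta_fps_3_2[where 'a = complex] psi_fps_dilate_mult_euler theta_fps_6_3_minus[where 'a = complex]
      theta_fps_6_5_minus[where 'a = complex] cubic_identity_psi cubic_identity_phi trisected_PD_equation
    by (simp_all add: P_def S_def R_def Q_def U_def E_def q_def mult.assoc)
  note feqs = eqs[THEN arg_cong, of ?f, unfolded hom]
  have "?f U = ?f (E 3) ^ 9 / (?f (E 1) ^ 7 * ?f (E 2) * ?f (E 6) ^ 3) - 2 * ?f q * ?f (E 6) ^ 6 / (?f (E 1) ^ 4 * ?f (E 2) ^ 4)"
    by (rule trisected_PD_field[OF nz nz nz nz feqs]) auto
  also have "\<dots> = ?f (E 2) ^ 5 * ?f (E 3) ^ 3 / (?f (E 1) ^ 5 * ?f (E 6) ^ 3) *
      (?f (E 4) ^ 6 * ?f (E 6) ^ 4 / (?f (E 2) ^ 10 * ?f (E 12) ^ 2) + 3 * ?f q ^ 2 * (?f (E 12) ^ 6 / (?f (E 2) ^ 6 * ?f (E 4) ^ 2)))"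
  proof (rule final_field_identity)
    have "?f (E 3 ^ 3 / E 1) = ?f (E 4 ^ 3 * (E 6)\<^sup>2 / ((E 2)\<^sup>2 * E 12) + q * (E 12 ^ 3 / E 4))"
      using euler_fps_2_dissection by (simp add: E_def q_def)
    thus "?f (E 3) ^ 3 / ?f (E 1) = ?f (E 4) ^ 3 * ?f (E 6) ^ 2 / (?f (E 2) ^ 2 * ?f (E 12)) + ?f q * (?f (E 12) ^ 3 / ?f (E 4))"
      by (simp add: fps_to_fls_divide_unit E0 P0 hom)
    have "(E 4 ^ 3 * E 6 ^ 9 + q\<^sup>2 * E 2 ^ 3 * E 12 ^ 9) * E 2 = E 4 ^ 8 * E 6 ^ 4 * E 12"
      using cubic_identity_psi_dilated by (simp add: E_def q_def)
    from arg_cong[OF this, of ?f]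
    show "(?f (E 4) ^ 3 * ?f (E 6) ^ 9 + ?f q ^ 2 * ?f (E 2) ^ 3 * ?f (E 12) ^ 9) * ?f (E 2) = ?f (E 4) ^ 8 * ?f (E 6) ^ 4 * ?f (E 12)"
      by (simp only: hom)
  qed (rule nz, simp)+
  also have "?f (E 2) ^ 5 * ?f (E 3) ^ 3 / (?f (E 1) ^ 5 * ?f (E 6) ^ 3) = 1 / (?f (u 1) ^ 5 * ?f (u 3) ^ 2 * ?f (u 5) ^ 5)"
  proof -
    have u: "E 1 = u 1 * u 2 * u 3 * u 4 * u 5 * E 6" "E 2 = u 2 * u 4 * E 6" "E 3 = u 3 * E 6"
      unfolding E_def u_def q_def by (rule euler_fps_sections_6)+
    \<comment> \<open>The residues 1 and 5 are what remains of \<open>f_1\<close> once the residues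
      2, 4 and 3 are divided out, so \<open>u 1 * u 5 = f_1 * f_6 / (f_2 * f_3)\<close>. Together
      with \<open>u 3 = f_3 / f_6\<close> this rewrites the prefactor.\<close>
    have "(u 1 * u 5) * (E 2 * E 3) = E 1 * E 6"
      by (simp only: u(2,3)) (simp only: u(1) mult_ac)
    from arg_cong[OF this, of ?f] have 1: "(?f (u 1) * ?f (u 5)) * (?f (E 2) * ?f (E 3)) = ?f (E 1) * ?f (E 6)"
      by (simp only: hom)
    have 3: "?f (u 3) = ?f (E 3) / ?f (E 6)"
      using arg_cong[OF u(3), of ?f] nz by (simp add: hom)
    have 15: "?f (u 1) * ?f (u 5) = ?f (E 1) * ?f (E 6) / (?f (E 2) * ?f (E 3))"
      using 1 nz by (simp add: nonzero_eq_divide_eq)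
    have "?f (u 1) ^ 5 * ?f (u 3) ^ 2 * ?f (u 5) ^ 5 = (?f (u 1) * ?f (u 5)) ^ 5 * ?f (u 3) ^ 2"
      by (simp add: power_mult_distrib)
    also have "1 / \<dots> = ?f (E 2) ^ 5 * ?f (E 3) ^ 3 / (?f (E 1) ^ 5 * ?f (E 6) ^ 3)"
      unfolding 15 3 using nz[of 1] nz[of 2] nz[of 3] nz[of 6] by (simp add: divide_simps, algebra?)
    finally show ?thesis ..
  qed
  finally have "?f U = ?f (1 / (u 1 ^ 5 * u 3 ^ 2 * u 5 ^ 5) *
      (E 4 ^ 6 * E 6 ^ 4 / (E 2 ^ 10 * E 12 ^ 2) + 3 * q\<^sup>2 * (E 12 ^ 6 / (E 2 ^ 6 * E 4 ^ 2))))"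
    by (simp add: hom fps_to_fls_divide_unit E0 u0 P0)
  thus ?thesis
    by (simp add: U_def u_def E_def euler_fps_def flip: q_def)
qed

end
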